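(* Let $T$ be a geodesic tetrahedron in $\mathbb{S}^3$, $\mathbb{R}^3$ or $\mathbb{H}^3$ with vertices $A_1,A_2,A_3,A_4$, edge lengths $l_{ij}$ and dihedral angles $\alpha_{ij}$. Then the configurations (ordered $8$-tuples of points of $\mathbb{P}^1=\mathbb{C}\cup\{\infty\}$) $\Omega(T)$ and $\Pi(T)$ are projectively equivalent, i.e. there is a projective transformation of $\mathbb{P}^1$ sending $\Omega(T)$ to $\Pi(T)$ term by term.
   Context: For $1\le i<j\le 4$, $l_{ij}=l_{ji}\in\mathbb{R}$ is the length of the edge $A_iA_j$ and $\alpha_{ij}=\alpha_{ji}\in\mathbb{R}/2\pi\mathbb{Z}$ is the dihedral angle of $T$ at the edge $A_iA_j$. The tetrahedron is called spherical, Euclidean or hyperbolic if it lies in $\mathbb{S}^3$, $\mathbb{R}^3$ or $\mathbb{H}^3$ respectively. Put \begin{align*} &\Pi_{123}=l_{12}+l_{13}+l_{23}, && \Omega_{123}=\alpha_{14}+\alpha_{24}+\alpha_{34}-\pi,\\ &\Pi_{124}=l_{12}+l_{14}+l_{24}, && \Omega_{124}=\alpha_{13}+\alpha_{23}+\alpha_{34}-\pi,\\ &\Pi_{134}=l_{13}+l_{14}+l_{34}, && \Omega_{134}=\alpha_{12}+\alpha_{23}+\alpha_{24}-\pi,\\ &\Pi_{234}=l_{23}+l_{24}+l_{34}, && \Omega_{234}=\alpha_{12}+\alpha_{13}+\alpha_{14}-\pi,\\ &\Pi_{1234}=l_{12}+l_{23}+l_{34}+l_{41}, && \Omega_{1234}=\alpha_{12}+\alpha_{23}+\alpha_{34}+\alpha_{41},\\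 &\Pi_{1324}=l_{13}+l_{32}+l_{24}+l_{41}, && \Omega_{1324}=\alpha_{13}+\alpha_{32}+\alpha_{24}+\alpha_{41},\\ &\Pi_{1243}=l_{12}+l_{24}+l_{43}+l_{31}, && \Omega_{1243}=\alpha_{12}+\alpha_{24}+\alpha_{43}+\alpha_{31}. \end{align*} Then $$\Omega(T)=\left(1,e^{i\Omega_{123}},e^{i\Omega_{124}},e^{i\Omega_{134}},e^{i\Omega_{234}},e^{i\Omega_{1234}},e^{i\Omega_{1324}},e^{i\Omega_{1243}}\right),$$ and $\Pi(T)$ is $$\left(1,e^{i\Pi_{123}},e^{i\Pi_{124}},e^{i\Pi_{134}},e^{i\Pi_{234}},e^{i\Pi_{1234}},e^{i\Pi_{1324}},e^{i\Pi_{1243}}\right)\ \text{if } T \text{ is spherical},$$ $$\left(0,\Pi_{123},\Pi_{124},\Pi_{134},\Pi_{234},\Pi_{1234},\Pi_{1324},\Pi_{1243}\right)\ \text{if } T \text{ is Euclidean},$$ $$\left(1,e^{\Pi_{123}},e^{\Pi_{124}},e^{\Pi_{134}},e^{\Pi_{234}},e^{\Pi_{1234}},e^{\Pi_{1324}},e^{\Pi_{1243}}\right)\ \text{if } T \text{ is hyperbolic}.$$ *)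

theory Defs
  imports "HOL-Analysis.Analysis"
begin

text \<open>The complex projective line as \<open>\<complex> \<union> {\<infinity>}\<close>.\<close>

datatype proj_line = Aff complex | Infty

fun proj_moebius :: "complex \<Rightarrow> complex \<Rightarrow> complex \<Rightarrow> complex \<Rightarrow> proj_line \<Rightarrow> proj_line" where
  "proj_moebius a b c d (Aff z) = (if c * z + d = 0 then Infty else Aff (moebius a b c d z))"
| "proj_moebius a b c d Infty = (if c = 0 then Infty else Aff (a / c))"

definition projective_transformation :: "(proj_line \<Rightarrow> proj_line) \<Rightarrow> bool" where
  "projective_transformation f \<longleftrightarrow> (\<exists>a b c d. a * d - b * c \<noteq> 0 \<and> f = proj_moebius a b c d)"

definition projectively_equivalent :: "proj_line list \<Rightarrow> proj_line list \<Rightarrow> bool" where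
  "projectively_equivalent xs ys \<longleftrightarrow> (\<exists>f. projective_transformation f \<and> map f xs = ys)"

text \<open>Hyperbolic space is the upper sheet of the hyperboloid in Minkowski space; the time
  coordinate is the one with index \<open>4\<close> (which equals \<open>0\<close> in the index type \<open>4\<close>).\<close>

definition lorentz :: "real ^ 4 \<Rightarrow> real ^ 4 \<Rightarrow> real" where
  "lorentz x y = x $ 1 * y $ 1 + x $ 2 * y $ 2 + x $ 3 * y $ 3 - x $ 4 * y $ 4"

definition hyperboloid :: "(real ^ 4) set" where
  "hyperboloid = {x. lorentz x x = - 1 \<and> x $ 4 > 0}"

text \<open>A tetrahedron is given by its vertices \<open>A 1, A 2, A 3, A 4\<close>; the constructor records the
  ambient geometry.\<close>

datatype tetrahedron =
    Spherical "4 \<Rightarrow> real ^ 4"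
  | Euclidean "4 \<Rightarrow> real ^ 3"
  | Hyperbolic "4 \<Rightarrow> real ^ 4"

text \<open>In the first and the last case linear independence says that the vertices do not lie on a
  common totally geodesic surface; in particular no two
  vertices are antipodal, and the edges are the unique minimal geodesics between them.\<close>

fun geodesic_tetrahedron :: "tetrahedron \<Rightarrow> bool" where
  "geodesic_tetrahedron (Spherical A) \<longleftrightarrow>
     range A \<subseteq> sphere 0 1 \<and> inj A \<and> independent (range A)"
| "geodesic_tetrahedron (Euclidean A) \<longleftrightarrow> inj A \<and> \<not> affine_dependent (range A)"
| "geodesic_tetrahedron (Hyperbolic A) \<longleftrightarrow>
     range A \<subseteq> hyperboloid \<and> inj A \<and> independent (range A)"

fun edge_length :: "tetrahedron \<Rightarrow> 4 \<Rightarrow> 4 \<Rightarrow> real" where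
  "edge_length (Spherical A) i j = arccos (A i \<bullet> A j)"
| "edge_length (Euclidean A) i j = dist (A i) (A j)"
| "edge_length (Hyperbolic A) i j = arcosh (- lorentz (A i) (A j))"

text \<open>For a bilinear form \<open>B\<close> that is positive definite on the relevant tangent space:
  the component of \<open>v\<close> orthogonal to \<open>u\<close>, the angle between two vectors, and the angle between
  the half-planes bounded by the line through \<open>u\<close> and containing \<open>v\<close> and \<open>w\<close> respectively.\<close>

definition orth_component ::
    "('v \<Rightarrow> 'v \<Rightarrow> real) \<Rightarrow> 'v \<Rightarrow> 'v \<Rightarrow> 'v::real_vector" where
  "orth_component B u v = v - (B v u / B u u) *\<^sub>R u"

definition form_angle :: "('v \<Rightarrow> 'v \<Rightarrow> real) \<Rightarrow> 'v \<Rightarrow> 'v \<Rightarrow> real" where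
  "form_angle B v w = arccos (B v w / (sqrt (B v v) * sqrt (B w w)))"

definition half_plane_angle ::
    "('v \<Rightarrow> 'v \<Rightarrow> real) \<Rightarrow> 'v \<Rightarrow> 'v \<Rightarrow> 'v::real_vector \<Rightarrow> real" where
  "half_plane_angle B u v w = form_angle B (orth_component B u v) (orth_component B u w)"

text \<open>A positive multiple of the initial velocity at \<open>p\<close> of the geodesic from \<open>p\<close> to \<open>q\<close>, that is,
  the projection of \<open>q\<close> to the tangent space at \<open>p\<close>.  The sign in the hyperbolic case comes from
  \<open>lorentz p p = - 1\<close>.\<close>

definition sphere_dir :: "real ^ 4 \<Rightarrow> real ^ 4 \<Rightarrow> real ^ 4" where
  "sphere_dir p q = q - (p \<bullet> q) *\<^sub>R p"

definition hyperboloid_dir :: "real ^ 4 \<Rightarrow> real ^ 4 \<Rightarrow> real ^ 4" where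
  "hyperboloid_dir p q = q + lorentz p q *\<^sub>R p"

text \<open>For \<open>{i, j, k, m} = {1, 2, 3, 4}\<close>: the interior dihedral angle, in \<open>(0, \<pi>)\<close>, at the edge
  \<open>A i A j\<close>, i.e. between the faces \<open>A i A j A k\<close> and \<open>A i A j A m\<close>, measured in the tangent
  space at \<open>A i\<close>.\<close>

fun dihedral_angle :: "tetrahedron \<Rightarrow> 4 \<Rightarrow> 4 \<Rightarrow> 4 \<Rightarrow> 4 \<Rightarrow> real" where
  "dihedral_angle (Spherical A) i j k m =
     half_plane_angle (\<bullet>)
       (sphere_dir (A i) (A j)) (sphere_dir (A i) (A k)) (sphere_dir (A i) (A m))"
| "dihedral_angle (Euclidean A) i j k m =
     half_plane_angle (\<bullet>) (A j - A i) (A k - A i) (A m - A i)"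
| "dihedral_angle (Hyperbolic A) i j k m =
     half_plane_angle lorentz
       (hyperboloid_dir (A i) (A j)) (hyperboloid_dir (A i) (A k)) (hyperboloid_dir (A i) (A m))"

definition Omegas :: "tetrahedron \<Rightarrow> real list" where
  "Omegas T =
     (let a12 = dihedral_angle T 1 2 3 4;
          a13 = dihedral_angle T 1 3 2 4;
          a14 = dihedral_angle T 1 4 2 3;
          a23 = dihedral_angle T 2 3 1 4;
          a24 = dihedral_angle T 2 4 1 3;
          a34 = dihedral_angle T 3 4 1 2
      in [a14 + a24 + a34 - pi,
          a13 + a23 + a34 - pi,
          a12 + a23 + a24 - pi,
          a12 + a13 + a14 - pi,
          a12 + a23 + a34 + a14,
          a13 + a23 + a24 + a14,
          a12 + a24 + a34 + a13])"

definition Pis :: "tetrahedron \<Rightarrow> real list" where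
  "Pis T =
     (let l12 = edge_length T 1 2;
          l13 = edge_length T 1 3;
          l14 = edge_length T 1 4;
          l23 = edge_length T 2 3;
          l24 = edge_length T 2 4;
          l34 = edge_length T 3 4
      in [l12 + l13 + l23,
          l12 + l14 + l24,
          l13 + l14 + l34,
          l23 + l24 + l34,
          l12 + l23 + l34 + l14,
          l13 + l23 + l24 + l14,
          l12 + l24 + l34 + l13])"

definition Omega_config :: "tetrahedron \<Rightarrow> proj_line list" where
  "Omega_config T = Aff 1 # map (\<lambda>t. Aff (exp (\<i> * of_real t))) (Omegas T)"

definition Pi_config :: "tetrahedron \<Rightarrow> proj_line list" where
  "Pi_config T =
     (case T of
        Spherical A \<Rightarrow> Aff 1 # map (\<lambda>t. Aff (exp (\<i> * of_real t))) (Pis T)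
      | Euclidean A \<Rightarrow> Aff 0 # map (\<lambda>t. Aff (of_real t)) (Pis T)
      | Hyperbolic A \<Rightarrow> Aff 1 # map (\<lambda>t. Aff (of_real (exp t))) (Pis T))"

end

theory Submission
  imports Defs
begin

text \<open>Write \<open>cot\<close> of a length for the quotient of \<open>cos\<close> by
\<open>sin\<close>, of \<open>cosh\<close> by \<open>sinh\<close>, or of \<open>1\<close> by the identity,
depending on the geometry. The theorem amounts to the existence of constants \<open>a\<close>,
\<open>b\<close> and \<open>c\<close>, with \<open>a\<close> and \<open>c\<close> nonzero, such that
\<open>a cot (\<Pi>/2) + b = c cot (\<Omega>/2)\<close> for the four faces and the three spatial
quadrilaterals, the value at \<open>\<infinity>\<close> of both sides accounting for the zeroth point. Since
\<open>e\<^sup>i\<^sup>\<Omega>\<close> and the points of \<open>\<Pi>(T)\<close> are Moebius functions of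
these half-angle cotangents, an affine relation between the cotangents is a projective equivalence of the
configurations.

At a vertex the three edges span a trihedral angle in the (Euclidean) tangent space, and
\<open>\<Omega>\<close> of the opposite face is the area \<open>E\<close> of its spherical link. The
classical formula \<open>cot (E/2) = (1 + x + y + z) / sqrt (gram_det x y z)\<close>, with \<open>x\<close>,
\<open>y\<close>, \<open>z\<close> the cosines of the face angles, follows by multiplying the three dihedral
angles as unit complex numbers (lemma \<open>trihedral_product\<close>). Multiplying numerator and
denominator by the \<open>sin\<close> of the three edges turns the denominator into a quantity
\<open>d\<close> that is the same at all four vertices (lemma \<open>d_vertex_independent\<close>; in
spherical space \<open>d\<^sup>2\<close> is the Gram determinant of the vertices), which will be
\<open>c\<close>, and turns the numerator into a function \<open>N\<close> of the six edge lengths. The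
difference of two such numerators factors (lemma \<open>N_diff\<close>), and comparing the factors with the
subtraction formula for \<open>cot\<close> gives \<open>N = a cot (\<Pi>/2) + b\<close> for all four faces,
where \<open>a\<close> is four times the product of \<open>sin (\<Pi>/2)\<close> over the faces.

For the quadrilateral consisting of the edges other than an edge \<open>vw\<close> and its opposite edge,
\<open>\<Omega>\<close> is the sum of \<open>\<Omega>\<close> over the two faces opposite to
\<open>v\<close> and \<open>w\<close>, minus twice the dihedral angle at \<open>vw\<close>, up to a multiple
of \<open>2\<pi>\<close>. The real and imaginary parts of the resulting product of three complex numbers are
simplified by means of \<open>N_diff\<close> and of a formula for the sum of two numerators (lemma
\<open>N_add\<close>), and the same \<open>a\<close>, \<open>b\<close> and \<open>c\<close> reappear (lemmas
\<open>quadrilateral_angle_sum\<close> and \<open>quadrilateral_relation\<close>).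

All three geometries are handled by one computation. Edge lengths are complex numbers: a spherical length
\<open>t\<close> is represented by itself and a hyperbolic one by \<open>-\<i>t\<close>, so that both use
\<open>sin\<close> and \<open>cos\<close>; in the Euclidean case \<open>sin\<close> and \<open>cos\<close>
become \<open>t\<close> and \<open>1\<close>. The trigonometric identities needed are consequences of a few
functional equations which the two sets of functions share; these are collected in the locale
\<open>length_functions\<close>.\<close>

section \<open>Moebius transformations from a bilinear relation\<close>

lemma proj_moebius_Aff_eq:
  assumes "a * d - b * c \<noteq> 0" and "w * (c * z + d) = a * z + b"
  shows "proj_moebius a b c d (Aff z) = Aff w"
proof -
  have "c * z + d \<noteq> 0"
  proof
    assume 0: "c * z + d = 0"
    with assms(2) have "a * z + b = 0" by simp
    with 0 have "a * d - b * c = 0" by algebra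
    with assms(1) show False by simp
  qed
  with assms(2) show ?thesis by (simp add: moebius_def divide_eq_eq)
qed

text \<open>The relation is stated without a quotient, so that it can be checked as a polynomial identity;
the determinant rules out a vanishing denominator.\<close>
lemma projectively_equivalent_if_bilinear_relation:
  fixes a b c d :: complex
  assumes "a * d - b * c \<noteq> 0"
    and "list_all2 (\<lambda>z w. w * (c * z + d) = a * z + b) zs ws"
  shows "projectively_equivalent (map Aff zs) (map Aff ws)"
proof -
  have "map (proj_moebius a b c d) (map Aff zs) = map Aff ws"
    using assms(2)
    by (induction zs ws rule: list_all2_induct) (simp_all add: proj_moebius_Aff_eq[OF assms(1)] del: proj_moebius.simps)
  with assms(1) show ?thesis
    unfolding projectively_equivalent_def projective_transformation_def by blast
qed

section \<open>Functions of lengths\<close>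

text \<open>The function \<open>q\<close> makes it possible to expand a product of three values of
\<open>sn\<close> into a sum, uniformly in the geometry. For \<open>sn = sin\<close> the expansion is the
usual one, with \<open>q = - sin\<close>; for \<open>sn x = x\<close> the role of \<open>q\<close> is taken
by the cubic term \<open>x\<^sup>3 / 6\<close> of \<open>- sin\<close>, because the four arguments \<open>x
+ y + z\<close>, \<open>-(x + y - z)\<close>, \<open>-(x - y + z)\<close>, \<open>-(y + z - x)\<close> add
up to \<open>0\<close> and the linear terms cancel. The equation \<open>ptolemy\<close> is Ptolemy's theorem
for a cyclic quadrilateral with half-arcs \<open>x\<close>, \<open>y\<close>, \<open>z\<close>.\<close>
locale length_functions =
  fixes sn cs q :: "complex \<Rightarrow> complex"
  assumes sn_0: "sn 0 = 0"
    and q_minus: "q (- x) = - q x"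
    and sn_diff: "sn (x - y) = sn x * cs y - cs x * sn y"
    and ptolemy: "sn (x + y) * sn (y + z) = sn x * sn z + sn y * sn (x + y + z)"
    and triple_product:
      "4 * sn x * sn y * sn z = q (x + y + z) - q (x + y - z) - q (x - y + z) - q (y + z - x)"
begin

lemma q_reverse: "q (x - y) = - q (y - x)"
  using q_minus[of "y - x"] by simp

text \<open>The left-hand side is the form in which \<open>N\<close> arises at a vertex with edges
\<open>a\<close>, \<open>b\<close>, \<open>c\<close> and respective opposite edges \<open>a'\<close>,
\<open>b'\<close>, \<open>c'\<close>. On the right, the sums and differences of opposite edges appear
symmetrically, which makes the numerators of two vertices comparable.\<close>
lemma triple_products_at_vertex:
  "2 * sn a * sn ((b + c + a') / 2) * sn ((b + c - a') / 2)
   + 2 * sn b * sn ((a + c + b') / 2) * sn ((a + c - b') / 2)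
   + 2 * sn c * sn ((a + b + c') / 2) * sn ((a + b - c') / 2)
   - 2 * sn a * sn b * sn c
   = q (a + b + c) - (q (a + a') + q (a - a') + q (b + b') + q (b - b') + q (c + c') + q (c - c')) / 2"
    (is "?l = ?r")
proof -
  have *: "4 * sn a * sn ((b + c + a') / 2) * sn ((b + c - a') / 2)
    = q (a + b + c) - q (a + a') - q (a - a') - q (b + c - a)" for a b c a'
    using triple_product[of a "(b + c + a') / 2" "(b + c - a') / 2"]
    by (simp add: add_divide_distrib diff_divide_distrib algebra_simps)
  have **: "4 * sn a * sn b * sn c = q (a + b + c) - q (a + b - c) - q (a + c - b) - q (b + c - a)"
    using triple_product[of a b c] by (simp add: algebra_simps)
  have r: "2 * ?r = 2 * q (a + b + c)
      - (q (a + a') + q (a - a') + q (b + b') + q (b - b') + q (c + c') + q (c - c'))"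
    by (simp add: algebra_simps add_divide_distrib)
  have "b + a + c = a + b + c" "c + a + b = a + b + c" by simp_all
  with *[of a b c a'] *[of b a c b'] *[of c a b c'] ** have "2 * ?l = 2 * ?r"
    unfolding r by algebra
  then show ?thesis by (rule iffD1[OF mult_left_cancel[OF numeral_neq_zero]])
qed

text \<open>In this lemma and the following three, \<open>e\<close> is an edge and \<open>e'\<close> its
opposite edge, \<open>a\<close> and \<open>b\<close> are the other edges at one end of \<open>e\<close>, and
\<open>a'\<close> and \<open>b'\<close> are the edges opposite to \<open>a\<close> and \<open>b\<close>. The
first two match the difference and the sum of the numerators at the two ends of \<open>e\<close>.\<close>
lemma difference_product:
  "4 * sn ((a + b - a' - b') / 2) * sn ((b' + a + e) / 2) * sn ((a' + b + e) / 2)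
   = q (a + b + e) - q (a - a') - q (b - b') - q (a' + b' + e)"
  using triple_product[of "(a + b - a' - b') / 2" "(b' + a + e) / 2" "(a' + b + e) / 2"]
  by (simp add: add_divide_distrib diff_divide_distrib algebra_simps)

lemma sum_product:
  "4 * sn e * sn ((a + b + e') / 2) * sn ((a + b - e') / 2)
   + 4 * sn ((e + a' - b) / 2) * sn ((e + b' - a) / 2) * sn ((a + b + a' + b') / 2)
   = q (a + b + e) + q (a' + b' + e) - q (a + a') - q (b + b') - q (e + e') - q (e - e')"
proof -
  have 1: "4 * sn e * sn ((a + b + e') / 2) * sn ((a + b - e') / 2)
    = q (a + b + e) - q (e + e') - q (e - e') - q (a + b - e)"
    using triple_product[of e "(a + b + e') / 2" "(a + b - e') / 2"]
    by (simp add: add_divide_distrib diff_divide_distrib algebra_simps)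
  have 2: "4 * sn ((e + a' - b) / 2) * sn ((e + b' - a) / 2) * sn ((a + b + a' + b') / 2)
    = q (a' + b' + e) - q (e - (a + b)) - q (a + a') - q (b + b')"
    using triple_product[of "(e + a' - b) / 2" "(e + b' - a) / 2" "(a + b + a' + b') / 2"]
    by (simp add: add_divide_distrib diff_divide_distrib algebra_simps)
  show ?thesis unfolding 1 2 q_reverse[of e] by simp
qed

text \<open>These instances of \<open>ptolemy\<close> compare the two ends of \<open>e\<close>: the first
concerns the two faces that contain \<open>e\<close>, the second the two faces that contain
\<open>e'\<close>.\<close>
lemma ptolemy_hinge:
  "sn ((e + a - b') / 2) * sn ((e + b - a') / 2)
   = sn ((e + a' - b) / 2) * sn ((e + b' - a) / 2) + sn e * sn ((a + b - a' - b') / 2)"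
  using ptolemy[of "(e + a' - b) / 2" "(a + b - a' - b') / 2" "(e + b' - a) / 2"]
  by (simp add: add_divide_distrib diff_divide_distrib algebra_simps)

lemma ptolemy_quadrilateral:
  "sn ((a + b + e') / 2) * sn ((a + b - e') / 2)
   = sn ((a' + b' + e') / 2) * sn ((a' + b' - e') / 2)
     + sn ((a + b - a' - b') / 2) * sn ((a + b + a' + b') / 2)"
  using ptolemy[of "(a' + b' + e') / 2" "(a + b - a' - b') / 2" "(a' + b' - e') / 2"]
  by (simp add: add_divide_distrib diff_divide_distrib algebra_simps)

end

interpretation circular: length_functions sin cos "\<lambda>x. - sin x"
proof
  fix x y z :: complex
  show "sin (x + y) * sin (y + z) = sin x * sin z + sin y * sin (x + y + z)"
    unfolding sin_add cos_add using sin_cos_squared_add[of y] by algebra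
  show "4 * sin x * sin y * sin z
      = - sin (x + y + z) - - sin (x + y - z) - - sin (x - y + z) - - sin (y + z - x)"
    by (simp add: sin_add cos_add sin_diff cos_diff algebra_simps)
qed (simp_all add: sin_diff)

interpretation linear: length_functions "\<lambda>x. x" "\<lambda>x. 1" "\<lambda>x. x ^ 3 / 6"
  by standard (simp_all add: field_simps power3_eq_cube)

section \<open>Trihedral angles\<close>

text \<open>By the spherical law of cosines, the first three factors are positive multiples of
\<open>e\<^sup>i\<^sup>\<alpha>\<close> for the three dihedral angles \<open>\<alpha>\<close> of a trihedron
with face angle cosines \<open>x\<close>, \<open>y\<close>, \<open>z\<close>. With \<open>S\<close> the sum
of these angles, the identity thus says that \<open>- exp (\<i> S)\<close> is the quotient of \<open>1 + x +
y + z + \<i>d\<close> by its conjugate.\<close>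
lemma trihedral_product:
  fixes x y z d :: complex
  assumes "d\<^sup>2 = 1 + 2 * x * y * z - x\<^sup>2 - y\<^sup>2 - z\<^sup>2"
  shows "(x - y * z + \<i> * d) * (y - x * z + \<i> * d) * (z - x * y + \<i> * d) * (1 + x + y + z - \<i> * d)
    = - ((1 - x\<^sup>2) * (1 - y\<^sup>2) * (1 - z\<^sup>2)) * (1 + x + y + z + \<i> * d)"
proof -
  have "\<i>\<^sup>2 = -1" by simp
  then show ?thesis using assms by algebra
qed

definition form_cos :: "('v \<Rightarrow> 'v \<Rightarrow> real) \<Rightarrow> 'v \<Rightarrow> 'v \<Rightarrow> real" where
  "form_cos B v w = B v w / (sqrt (B v v) * sqrt (B w w))"

definition pos_def_on :: "('v::real_vector \<Rightarrow> 'v \<Rightarrow> real) \<Rightarrow> 'v \<Rightarrow> 'v \<Rightarrow> 'v \<Rightarrow> bool" where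
  "pos_def_on B u v w \<longleftrightarrow> (\<forall>a b c. (a \<noteq> 0 \<or> b \<noteq> 0 \<or> c \<noteq> 0) \<longrightarrow>
     0 < B (a *\<^sub>R u + b *\<^sub>R v + c *\<^sub>R w) (a *\<^sub>R u + b *\<^sub>R v + c *\<^sub>R w))"

text \<open>The Gram determinant of three unit vectors whose pairwise inner products are \<open>x\<close>,
\<open>y\<close>, \<open>z\<close>.\<close>
definition gram_det :: "real \<Rightarrow> real \<Rightarrow> real \<Rightarrow> real" where
  "gram_det x y z = 1 + 2 * x * y * z - x\<^sup>2 - y\<^sup>2 - z\<^sup>2"

text \<open>The spherical law of cosines in the tangent space, together with the matching formula for the
sine. The strict inequalities come from evaluating \<open>B\<close> at the Gram-Schmidt orthogonalisation of
\<open>u\<close>, \<open>v\<close>, \<open>w\<close>; they show that the argument of \<open>arccos\<close>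
lies in the interior of its domain.\<close>
lemma dihedral_angle_of_trihedron:
  fixes B :: "'v::real_vector \<Rightarrow> 'v \<Rightarrow> real"
  assumes bil: "bilinear B" and sym: "\<And>v w. B v w = B w v" and pos: "pos_def_on B u v w"
  defines "x \<equiv> form_cos B u v" and "y \<equiv> form_cos B u w" and "z \<equiv> form_cos B v w"
  shows "x\<^sup>2 < 1" "gram_det x y z > 0"
    "cis (half_plane_angle B u v w) * (sqrt (1 - x\<^sup>2) * sqrt (1 - y\<^sup>2))
      = Complex (z - x * y) (sqrt (gram_det x y z))"
proof -
  note [simp] = bilinear_ladd[OF bil] bilinear_radd[OF bil] bilinear_lmul[OF bil] bilinear_rmul[OF bil]
    bilinear_lsub[OF bil] bilinear_rsub[OF bil]
  have uu: "B u u > 0" and vv: "B v v > 0" and ww: "B w w > 0"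
    using pos[unfolded pos_def_on_def, rule_format, of 1 0 0]
      pos[unfolded pos_def_on_def, rule_format, of 0 1 0]
      pos[unfolded pos_def_on_def, rule_format, of 0 0 1] by simp_all
  define U V W where "U = sqrt (B u u)" and "V = sqrt (B v v)" and "W = sqrt (B w w)"
  have UVW: "U > 0" "V > 0" "W > 0" using uu vv ww by (simp_all add: U_def V_def W_def)
  have B: "B u u = U\<^sup>2" "B v v = V\<^sup>2" "B w w = W\<^sup>2"
      "B u v = x * U * V" "B u w = y * U * W" "B v w = z * V * W"
      "B v u = x * U * V" "B w u = y * U * W" "B w v = z * V * W"
    using UVW uu vv ww sym
    by (simp_all add: U_def V_def W_def x_def y_def z_def form_cos_def)
  define p r where "p = orth_component B u v" and "r = orth_component B u w"
  have p: "p = v - (x * V / U) *\<^sub>R u" and r: "r = w - (y * W / U) *\<^sub>R u"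
    using UVW by (simp_all add: p_def r_def orth_component_def B power2_eq_square)
  have Bpp: "B p p = V\<^sup>2 * (1 - x\<^sup>2)" and Brr: "B r r = W\<^sup>2 * (1 - y\<^sup>2)"
    and Bpr: "B p r = V * W * (z - x * y)"
    using UVW by (simp_all add: p r B field_simps power2_eq_square)
  have "B p p > 0" "B r r > 0"
    using pos[unfolded pos_def_on_def, rule_format, of "- (x * V / U)" 1 0]
      pos[unfolded pos_def_on_def, rule_format, of "- (y * W / U)" 0 1]
    by (simp_all add: p r algebra_simps)
  then have x1: "1 - x\<^sup>2 > 0" and y1: "1 - y\<^sup>2 > 0"
    using UVW by (simp_all add: Bpp Brr zero_less_mult_iff)
  then show "x\<^sup>2 < 1" by simp
  (* r - t p is the last Gram-Schmidt vector; its positive square is the Gram determinant up to a factor. *)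
  define t where "t = B p r / B p p"
  have "r - t *\<^sub>R p = (t * (x * V / U) - y * W / U) *\<^sub>R u + (- t) *\<^sub>R v + 1 *\<^sub>R w"
    by (simp add: p r algebra_simps)
  then have "B (r - t *\<^sub>R p) (r - t *\<^sub>R p) > 0"
    using pos[unfolded pos_def_on_def, rule_format, of "t * (x * V / U) - y * W / U" "- t" 1]
    by (metis zero_neq_one)
  moreover have "B (r - t *\<^sub>R p) (r - t *\<^sub>R p) = B r r - t * B p r"
    using \<open>B p p > 0\<close> sym[of r p] by (simp add: t_def field_simps)
  ultimately have "t * B p r < B r r" by linarith
  then have "(B p r)\<^sup>2 < B p p * B r r"
    using \<open>B p p > 0\<close> by (simp add: t_def field_simps power2_eq_square)
  then have "(V * W)\<^sup>2 * (z - x * y)\<^sup>2 < (V * W)\<^sup>2 * ((1 - x\<^sup>2) * (1 - y\<^sup>2))"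
    by (simp add: Bpp Brr Bpr power_mult_distrib mult_ac)
  then have less: "(z - x * y)\<^sup>2 < (1 - x\<^sup>2) * (1 - y\<^sup>2)"
    using UVW by simp
  have gram: "gram_det x y z = (1 - x\<^sup>2) * (1 - y\<^sup>2) - (z - x * y)\<^sup>2"
    unfolding gram_det_def by algebra
  show "gram_det x y z > 0" using less gram by simp
  define R where "R = sqrt (1 - x\<^sup>2) * sqrt (1 - y\<^sup>2)"
  have R: "R > 0" "R\<^sup>2 = (1 - x\<^sup>2) * (1 - y\<^sup>2)"
    using x1 y1 by (simp_all add: R_def power_mult_distrib)
  define C where "C = (z - x * y) / R"
  have C2: "C\<^sup>2 < 1" using less[folded R(2)] R(1) by (simp add: C_def power_divide divide_less_eq)
  then have C1: "\<bar>C\<bar> \<le> 1" by (simp add: abs_square_le_1[symmetric])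
  have "half_plane_angle B u v w = arccos C"
    using UVW x1 y1 unfolding half_plane_angle_def p_def[symmetric] r_def[symmetric] form_angle_def
    unfolding Bpp Brr Bpr C_def R_def real_sqrt_mult by simp
  moreover have "sqrt (1 - C\<^sup>2) * R = sqrt (gram_det x y z)"
  proof -
    have "gram_det x y z = (1 - C\<^sup>2) * R\<^sup>2"
      using R(1) unfolding gram R(2)[symmetric] by (simp add: C_def power_divide left_diff_distrib)
    then show ?thesis using R(1) by (simp add: real_sqrt_mult)
  qed
  moreover have "C * R = z - x * y" using R(1) by (simp add: C_def)
  ultimately show "cis (half_plane_angle B u v w) * (sqrt (1 - x\<^sup>2) * sqrt (1 - y\<^sup>2))
      = Complex (z - x * y) (sqrt (gram_det x y z))"
    unfolding R_def[symmetric] of_real_mult[symmetric] using C1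
    by (simp add: complex_eq_iff sin_arccos_abs cos_arccos_abs R_def)
qed

section \<open>The identities for a tetrahedron\<close>

text \<open>\<open>l\<close> gives the (complex) edge lengths, \<open>x v i j\<close> is the cosine of the
angle at \<open>v\<close> in the face \<open>v i j\<close>, and \<open>\<alpha> v w i j\<close> is the
dihedral angle at the edge \<open>vw\<close>, measured in the tangent space at \<open>v\<close>. The common
phase \<open>\<rho>\<close> is \<open>1\<close>, except in hyperbolic space, where \<open>sin (-\<i>t) =
-\<i> sinh t\<close> makes it \<open>-\<i>\<close>. It fixes signs where the identities only determine
squares.

The half-angle form of \<open>law_of_cosines\<close> is the one that also makes sense for \<open>sn x =
x\<close>.\<close>
locale tetrahedral_data = length_functions +
  fixes l :: "'v \<Rightarrow> 'v \<Rightarrow> complex" and x :: "'v \<Rightarrow> 'v \<Rightarrow> 'v \<Rightarrow> real"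
    and \<alpha> :: "'v \<Rightarrow> 'v \<Rightarrow> 'v \<Rightarrow> 'v \<Rightarrow> real" and \<rho> :: complex
  assumes l_commute: "l v w = l w v"
    and x_commute: "x v i j = x v j i"
    and rho_nonzero: "\<rho> \<noteq> 0"
    and sn_length: "v \<noteq> w \<Longrightarrow> \<exists>r>0. sn (l v w) = \<rho> * of_real r"
    and x_less_1: "distinct [v, i, j] \<Longrightarrow> (x v i j)\<^sup>2 < 1"
    and gram_det_pos: "distinct [v, i, j, k] \<Longrightarrow> gram_det (x v i j) (x v i k) (x v j k) > 0"
    and law_of_cosines: "distinct [v, i, j] \<Longrightarrow> sn (l v i) * sn (l v j) * (1 + x v i j)
      = 2 * sn ((l v i + l v j + l i j) / 2) * sn ((l v i + l v j - l i j) / 2)"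
    and dihedral: "distinct [v, w, i, j] \<Longrightarrow>
      cis (\<alpha> v w i j) * (sqrt (1 - (x v w i)\<^sup>2) * sqrt (1 - (x v w j)\<^sup>2))
      = Complex (x v i j - x v w i * x v w j) (sqrt (gram_det (x v w i) (x v w j) (x v i j)))"
begin

definition s :: "'v \<Rightarrow> 'v \<Rightarrow> complex" where
  "s v w = sn (l v w)"

text \<open>\<open>P\<close> and \<open>T\<close> are the factors in Heron-type formulas for the face
\<open>v i j\<close>: the values of \<open>sn\<close> at half the perimeter, and at half the perimeter minus
the side opposite to \<open>v\<close>.\<close>
definition P :: "'v \<Rightarrow> 'v \<Rightarrow> 'v \<Rightarrow> complex" where
  "P v i j = sn ((l v i + l v j + l i j) / 2)"

definition T :: "'v \<Rightarrow> 'v \<Rightarrow> 'v \<Rightarrow> complex" where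
  "T v i j = sn ((l v i + l v j - l i j) / 2)"

definition h :: "'v \<Rightarrow> 'v \<Rightarrow> 'v \<Rightarrow> complex" where
  "h v i j = s v i * s v j * (1 + x v i j)"

text \<open>With \<open>\<Omega>\<close> the invariant of the face \<open>i j k\<close>, the quotient of
\<open>N v i j k\<close> by \<open>d v i j k\<close> is \<open>cot (\<Omega>/2)\<close>; see
\<open>vertex_angle_sum\<close>. Similarly \<open>G v w i j\<close> divided by \<open>d v i j w * s v
w\<close> is the cotangent of the dihedral angle at the edge \<open>vw\<close>; see
\<open>u_direction\<close>.\<close>
definition N :: "'v \<Rightarrow> 'v \<Rightarrow> 'v \<Rightarrow> 'v \<Rightarrow> complex" where
  "N v i j k = s v i * s v j * s v k * (1 + x v i j + x v i k + x v j k)"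

definition d :: "'v \<Rightarrow> 'v \<Rightarrow> 'v \<Rightarrow> 'v \<Rightarrow> complex" where
  "d v i j k = s v i * s v j * s v k * sqrt (gram_det (x v i j) (x v i k) (x v j k))"

definition G :: "'v \<Rightarrow> 'v \<Rightarrow> 'v \<Rightarrow> 'v \<Rightarrow> complex" where
  "G v w i j = s v w * N v w i j - h v w i * h v w j"

lemma s_commute: "s v w = s w v"
  by (simp add: s_def l_commute[of v w])

lemma P_commute: "P v i j = P i v j" "P v i j = P v j i"
  unfolding P_def l_commute[of v i] l_commute[of i j] by (simp_all add: add_ac)

lemma T_commute: "T v i j = T v j i"
  unfolding T_def l_commute[of i j] by (simp add: add_ac)

lemma N_commute: "N v i j k = N v j i k" "N v i j k = N v i k j"
  unfolding N_def x_commute[of v i j] x_commute[of v j k] by (simp_all add: mult_ac add_ac)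

lemma d_commute: "d v i j k = d v j i k" "d v i j k = d v i k j"
  unfolding d_def gram_det_def x_commute[of v i j] x_commute[of v j k] by (simp_all add: mult_ac add_ac)

lemma s_nonzero: "v \<noteq> w \<Longrightarrow> s v w \<noteq> 0"
  using sn_length[of v w] rho_nonzero by (auto simp: s_def)

lemma h_eq: "distinct [v, i, j] \<Longrightarrow> h v i j = 2 * P v i j * T v i j"
  unfolding h_def s_def P_def T_def by (rule law_of_cosines)

lemma h_nonzero:
  assumes "distinct [v, i, j]"
  shows "h v i j \<noteq> 0"
proof -
  have "x v i j \<noteq> - 1" using x_less_1[OF assms] by auto
  then have "1 + complex_of_real (x v i j) \<noteq> 0"
    by (metis add_eq_0_iff2 add.commute minus_equation_iff of_real_1 of_real_eq_iff of_real_minus)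
  with assms s_nonzero show ?thesis by (simp add: h_def)
qed

lemma P_nonzero: "distinct [v, i, j] \<Longrightarrow> P v i j \<noteq> 0"
  and T_nonzero: "distinct [v, i, j] \<Longrightarrow> T v i j \<noteq> 0"
  using h_nonzero[of v i j] h_eq[of v i j] by auto

lemma N_via_q:
  assumes "distinct [v, i, j, k]"
  shows "N v i j k = q (l v i + l v j + l v k)
    - (q (l v i + l j k) + q (l v i - l j k) + q (l v j + l i k) + q (l v j - l i k)
       + q (l v k + l i j) + q (l v k - l i j)) / 2"
proof -
  have "N v i j k = s v i * h v j k + s v j * h v i k + s v k * h v i j - 2 * s v i * s v j * s v k"
    unfolding N_def h_def by (simp add: algebra_simps)
  also have "\<dots> = q (l v i + l v j + l v k)
    - (q (l v i + l j k) + q (l v i - l j k) + q (l v j + l i k) + q (l v j - l i k)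
       + q (l v k + l i j) + q (l v k - l i j)) / 2"
    unfolding triple_products_at_vertex[symmetric]
    using assms by (simp add: h_eq P_def T_def s_def mult_ac)
  finally show ?thesis .
qed

text \<open>The sum \<open>N\<^sup>2 + d\<^sup>2\<close> is a product because \<open>(1 + x + y + z)\<^sup>2
+ gram_det x y z = 2 (1 + x) (1 + y) (1 + z)\<close>.\<close>
lemma d_square: "(d v i j k)\<^sup>2 = 2 * h v i j * h v i k * h v j k - (N v i j k)\<^sup>2"
  if "distinct [v, i, j, k]"
proof -
  define r where "r = complex_of_real (sqrt (gram_det (x v i j) (x v i k) (x v j k)))"
  have "r\<^sup>2 = of_real (gram_det (x v i j) (x v i k) (x v j k))"
    using gram_det_pos[OF that] by (simp add: r_def flip: of_real_power)
  then have "r\<^sup>2 = 1 + 2 * x v i j * x v i k * x v j k - (x v i j)\<^sup>2 - (x v i k)\<^sup>2 - (x v j k)\<^sup>2"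
    by (simp add: gram_det_def)
  then show ?thesis
    unfolding d_def h_def N_def r_def[symmetric] of_real_add of_real_diff of_real_mult of_real_power of_real_1 of_real_numeral
    by algebra
qed

text \<open>The numerators at the two ends of the edge \<open>vw\<close> in a common form: the middle
bracket is shared, while the last one changes its sign because \<open>q\<close> is odd.\<close>
lemma N_hinge:
  assumes "distinct [v, w, i, j]"
  shows "2 * N v i j w = 2 * q (l v i + l v j + l v w)
      - (q (l v i + l w j) + q (l v j + l w i) + q (l v w + l i j) + q (l v w - l i j))
      - (q (l v i - l w j) + q (l v j - l w i))"
    and "2 * N w i j v = 2 * q (l w i + l w j + l v w)
      - (q (l v i + l w j) + q (l v j + l w i) + q (l v w + l i j) + q (l v w - l i j))
      + (q (l v i - l w j) + q (l v j - l w i))"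
proof -
  have dist: "distinct [v, i, j, w]" "distinct [w, i, j, v]" using assms by auto
  show "2 * N v i j w = 2 * q (l v i + l v j + l v w)
      - (q (l v i + l w j) + q (l v j + l w i) + q (l v w + l i j) + q (l v w - l i j))
      - (q (l v i - l w j) + q (l v j - l w i))"
    unfolding N_via_q[OF dist(1)] l_commute[of j w] l_commute[of i w]
    by (simp add: right_diff_distrib add_divide_distrib)
  show "2 * N w i j v = 2 * q (l w i + l w j + l v w)
      - (q (l v i + l w j) + q (l v j + l w i) + q (l v w + l i j) + q (l v w - l i j))
      + (q (l v i - l w j) + q (l v j - l w i))"
    unfolding N_via_q[OF dist(2)] l_commute[of j v] l_commute[of i v] l_commute[of w v]
      q_reverse[of "l w i" "l v j"] q_reverse[of "l w j" "l v i"]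
    by (simp add: right_diff_distrib add_divide_distrib diff_divide_distrib
        add.commute[of "l w i"] add.commute[of "l w j" "l v i"])
qed

text \<open>The right-hand side involves \<open>P\<close> of the two faces that contain \<open>vw\<close>,
and the first factor is \<open>sn\<close> of half the difference of the perimeters of the other two faces.
This is what makes \<open>N\<close> affine in \<open>cot (\<Pi>/2)\<close>.\<close>
lemma N_diff:
  assumes "distinct [v, w, i, j]"
  shows "N v i j w - N w i j v = 4 * sn ((l v i + l v j - l w i - l w j) / 2) * P v w i * P v w j"
proof -
  have "4 * sn ((l v i + l v j - l w i - l w j) / 2) * P v w i * P v w j
      = q (l v i + l v j + l v w) - q (l v i - l w j) - q (l v j - l w i) - q (l w i + l w j + l v w)"
    using difference_product[of "l v i" "l v j" "l w j" "l w i" "l v w"]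
    by (simp add: P_def add_ac diff_diff_eq)
  with N_hinge[OF assms] show ?thesis by algebra
qed

text \<open>The sum is not itself a product; by \<open>h_eq\<close> the first summand on the right is
\<open>2 * s v w * h v i j\<close>, which is exactly what cancels in the imaginary part computed in
\<open>quadrilateral_angle_sum\<close>.\<close>
lemma N_add:
  assumes "distinct [v, w, i, j]"
  shows "N v i j w + N w i j v = 4 * s v w * P v i j * T v i j
    + 4 * T w v i * T w v j * sn ((l v i + l v j + l w i + l w j) / 2)"
proof -
  have "4 * s v w * P v i j * T v i j
    + 4 * T w v i * T w v j * sn ((l v i + l v j + l w i + l w j) / 2)
    = q (l v i + l v j + l v w) + q (l w i + l w j + l v w) - q (l v i + l w j) - q (l v j + l w i)
      - q (l v w + l i j) - q (l v w - l i j)"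
    using sum_product[of "l v w" "l v i" "l v j" "l i j" "l w j" "l w i"]
    by (simp add: P_def T_def s_def l_commute[of w v] add_ac mult_ac)
  with N_hinge[OF assms] show ?thesis by algebra
qed

lemma hinge_identities:
  shows "T v w i * T v w j = T w v i * T w v j + s v w * sn ((l v i + l v j - l w i - l w j) / 2)"
    and "P v i j * T v i j = P w i j * T w i j
      + sn ((l v i + l v j - l w i - l w j) / 2) * sn ((l v i + l v j + l w i + l w j) / 2)"
  using ptolemy_hinge[of "l v w" "l v i" "l w i" "l v j" "l w j"]
    ptolemy_quadrilateral[of "l v i" "l v j" "l i j" "l w i" "l w j"]
  by (simp_all add: P_def T_def s_def l_commute[of w v] add_ac mult_ac diff_diff_eq)

text \<open>By \<open>d_square\<close> the claim for the squares concerns the difference of the squares of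
two numerators, which \<open>N_diff\<close> and \<open>N_add\<close> express by values of \<open>sn\<close>; what
remains is Ptolemy's theorem in the two instances \<open>hinge_identities\<close>. The sign of the square root is
settled by the common phase \<open>\<rho>\<^sup>3\<close>.\<close>
lemma d_vertex_independent:
  assumes "distinct [v, w, i, j]"
  shows "d v i j w = d w i j v"
proof -
  have dist: "distinct [v, i, j, w]" "distinct [w, i, j, v]" using assms by auto
  have "(d v i j w)\<^sup>2 = (d w i j v)\<^sup>2"
  proof -
    have "h v i j = 2 * P v i j * T v i j" "h w i j = 2 * P w i j * T w i j"
      "h v i w = 2 * P v w i * T v w i" "h v j w = 2 * P v w j * T v w j"
      "h w i v = 2 * P v w i * T w v i" "h w j v = 2 * P v w j * T w v j"
      using assms by (auto simp: h_eq P_commute T_commute)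
    then show ?thesis
      using N_diff[OF assms] N_add[OF assms] hinge_identities(1)[of v w i j] hinge_identities(2)[of v i j w]
        d_square[OF dist(1)] d_square[OF dist(2)] by algebra
  qed
  moreover have "\<exists>r>0. d v i j k = \<rho> ^ 3 * of_real r" if dist': "distinct [v, i, j, k]" for v i j k
  proof -
    obtain a b c where "a > 0" "b > 0" "c > 0"
      "s v i = \<rho> * of_real a" "s v j = \<rho> * of_real b" "s v k = \<rho> * of_real c"
      using dist' sn_length[of v i] sn_length[of v j] sn_length[of v k] by (auto simp: s_def)
    with gram_det_pos[OF dist'] show ?thesis
      by (intro exI[of _ "a * b * c * sqrt (gram_det (x v i j) (x v i k) (x v j k))"])
        (simp add: d_def power3_eq_cube)
  qed
  then obtain r r' where r: "r > 0" "d v i j w = \<rho> ^ 3 * of_real r"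
      and r': "r' > 0" "d w i j v = \<rho> ^ 3 * of_real r'"
    using dist by meson
  ultimately have "complex_of_real (r\<^sup>2) = of_real (r'\<^sup>2)"
    using rho_nonzero by (simp add: power_mult_distrib)
  with r(1) r'(1) have "r = r'" unfolding of_real_eq_iff by simp
  with r r' show ?thesis by simp
qed

lemma d_nonzero: "distinct [v, i, j, k] \<Longrightarrow> d v i j k \<noteq> 0"
  using gram_det_pos[of v i j k] s_nonzero by (auto simp: d_def)

lemma G_reverse_edge:
  assumes "distinct [v, w, i, j]"
  shows "G v w i j = G w v i j"
proof -
  have "h v w i = 2 * P v w i * T v w i" "h v w j = 2 * P v w j * T v w j"
      "h w v i = 2 * P v w i * T w v i" "h w v j = 2 * P v w j * T w v j"
    using assms by (auto simp: h_eq P_commute)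
  moreover have "N v w i j = N v i j w" "N w v i j = N w i j v" by (simp_all add: N_commute)
  ultimately show ?thesis
    unfolding G_def using N_diff[OF assms] hinge_identities(1)[of v w i j] s_commute[of v w]
    by algebra
qed


definition u :: "'v \<Rightarrow> 'v \<Rightarrow> 'v \<Rightarrow> 'v \<Rightarrow> complex" where
  "u v w i j = cis (\<alpha> v w i j)"

lemma u_nonzero: "u v w i j \<noteq> 0"
  by (simp add: u_def)

lemma u_at_vertex:
  assumes "distinct [v, w, i, j]"
  shows "u v w i j * (complex_of_real (sqrt (1 - (x v w i)\<^sup>2)) * of_real (sqrt (1 - (x v w j)\<^sup>2)))
    = of_real (x v i j) - of_real (x v w i) * of_real (x v w j)
      + \<i> * of_real (sqrt (gram_det (x v w i) (x v w j) (x v i j)))"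
  using dihedral[OF assms] by (simp add: u_def Complex_eq)

text \<open>The two equations say that \<open>u\<^sup>2\<close> is the quotient of \<open>G + \<i> d
s\<close> by \<open>G - \<i> d s\<close>. Positivity of \<open>r\<close> determines \<open>u\<close> itself,
not only up to sign.\<close>
lemma u_direction:
  assumes "distinct [v, w, i, j]"
  shows "\<exists>r>0. u v w i j * (\<rho> ^ 4 * of_real r) = G v w i j + \<i> * d v i j w * s v w
    \<and> \<rho> ^ 4 * of_real r = u v w i j * (G v w i j - \<i> * d v i j w * s v w)"
proof -
  obtain a b c where abc: "a > 0" "b > 0" "c > 0"
    "s v w = \<rho> * of_real a" "s v i = \<rho> * of_real b" "s v j = \<rho> * of_real c"
    using assms sn_length[of v w] sn_length[of v i] sn_length[of v j] by (auto simp: s_def)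
  define R where "R = sqrt (1 - (x v w i)\<^sup>2) * sqrt (1 - (x v w j)\<^sup>2)"
  define m where "m = sqrt (gram_det (x v w i) (x v w j) (x v i j))"
  have R: "R > 0" using assms x_less_1[of v w i] x_less_1[of v w j] by (simp add: R_def)
  have u: "u v w i j * of_real R
      = of_real (x v i j) - of_real (x v w i) * of_real (x v w j) + \<i> * of_real m"
    using u_at_vertex[OF assms] by (simp add: R_def m_def)
  have cu: "cnj (u v w i j) * of_real R
      = of_real (x v i j) - of_real (x v w i) * of_real (x v w j) - \<i> * of_real m"
    using arg_cong[OF u, of cnj] by simp
  have ucu: "u v w i j * cnj (u v w i j) = 1"
    by (simp add: u_def cis_cnj cis_mult)
  have dm: "d v i j w = s v w * s v i * s v j * of_real m"
    by (simp add: d_def m_def gram_det_def x_commute[of v i w] x_commute[of v j w] mult_ac add_ac)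
  have G: "G v w i j = (s v w)\<^sup>2 * s v i * s v j * (of_real (x v i j) - of_real (x v w i) * of_real (x v w j))"
    unfolding G_def N_def h_def by (simp add: algebra_simps power2_eq_square)
  have "u v w i j * ((s v w)\<^sup>2 * s v i * s v j * of_real R) = G v w i j + \<i> * d v i j w * s v w"
    unfolding G dm using u by algebra
  moreover have "(s v w)\<^sup>2 * s v i * s v j * of_real R = u v w i j * (G v w i j - \<i> * d v i j w * s v w)"
    unfolding G dm using cu ucu by algebra
  moreover have "(s v w)\<^sup>2 * s v i * s v j * of_real R = \<rho> ^ 4 * of_real (a\<^sup>2 * b * c * R)"
    by (simp add: abc power_mult_distrib power4_eq_xxxx power2_eq_square)
  ultimately show ?thesis using abc R by (intro exI[of _ "a\<^sup>2 * b * c * R"]) simp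
qed

text \<open>The dihedral angle at an edge is the same whether it is measured at one end or at the other: by
\<open>G_reverse_edge\<close> and \<open>d_vertex_independent\<close> both unit complex numbers are positive
multiples of the same one, up to the phase \<open>\<rho>\<^sup>4\<close>.\<close>
lemma u_reverse_edge:
  assumes "distinct [v, w, i, j]"
  shows "u v w i j = u w v i j"
proof -
  have assms': "distinct [w, v, i, j]" using assms by auto
  obtain r r' where r: "r > 0" "u v w i j * (\<rho> ^ 4 * of_real r) = G v w i j + \<i> * d v i j w * s v w"
      and r': "r' > 0" "u w v i j * (\<rho> ^ 4 * of_real r') = G w v i j + \<i> * d w i j v * s w v"
    using u_direction[OF assms] u_direction[OF assms'] by blast
  then have eq: "u v w i j * of_real r = u w v i j * of_real r'"
    using rho_nonzero G_reverse_edge[OF assms] d_vertex_independent[OF assms] s_commute[of v w]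
    by (metis (no_types, opaque_lifting) mult.left_commute mult_left_cancel power_not_zero)
  then have "norm (u v w i j * of_real r) = norm (u w v i j * of_real r')" by simp
  with r(1) r'(1) have "r = r'" by (simp add: u_def norm_mult)
  with eq r(1) show ?thesis by simp
qed

lemma u_swap_faces:
  assumes "distinct [v, w, i, j]"
  shows "u v w i j = u v w j i"
proof -
  have assms': "distinct [v, w, j, i]" using assms by auto
  have "gram_det (x v w j) (x v w i) (x v j i) = gram_det (x v w i) (x v w j) (x v i j)"
    by (simp add: gram_det_def x_commute[of v j i])
  then have "u v w i j * (complex_of_real (sqrt (1 - (x v w i)\<^sup>2)) * of_real (sqrt (1 - (x v w j)\<^sup>2)))
    = u v w j i * (complex_of_real (sqrt (1 - (x v w i)\<^sup>2)) * of_real (sqrt (1 - (x v w j)\<^sup>2)))"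
    using u_at_vertex[OF assms] u_at_vertex[OF assms'] by (simp add: x_commute[of v j i] mult_ac)
  moreover have "sqrt (1 - (x v w i)\<^sup>2) \<noteq> 0" "sqrt (1 - (x v w j)\<^sup>2) \<noteq> 0"
    using assms x_less_1[of v w i] x_less_1[of v w j] by simp_all
  ultimately show ?thesis by simp
qed

lemma vertex_angle_sum:
  assumes "distinct [v, i, j, k]"
  shows "u v i j k * u v j i k * u v k i j * (N v i j k - \<i> * d v i j k)
    = - (N v i j k + \<i> * d v i j k)"
proof -
  define X Y Z where "X = complex_of_real (x v j k)" and "Y = complex_of_real (x v i k)"
    and "Z = complex_of_real (x v i j)"
  define m where "m = complex_of_real (sqrt (gram_det (x v i j) (x v i k) (x v j k)))"
  define A B C where "A = complex_of_real (sqrt (1 - (x v j k)\<^sup>2))"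
    and "B = complex_of_real (sqrt (1 - (x v i k)\<^sup>2))" and "C = complex_of_real (sqrt (1 - (x v i j)\<^sup>2))"
  have dist: "distinct [v, j, i, k]" "distinct [v, k, i, j]"
    and dist3: "distinct [v, j, k]" "distinct [v, i, k]" "distinct [v, i, j]" using assms by auto
  have sq: "A\<^sup>2 = 1 - X\<^sup>2" "B\<^sup>2 = 1 - Y\<^sup>2" "C\<^sup>2 = 1 - Z\<^sup>2" and nz: "A \<noteq> 0" "B \<noteq> 0" "C \<noteq> 0"
    using dist3[THEN x_less_1] by (simp_all add: A_def B_def C_def X_def Y_def Z_def flip: of_real_power)
  have "m\<^sup>2 = of_real (gram_det (x v i j) (x v i k) (x v j k))"
    using gram_det_pos[OF assms] by (simp add: m_def flip: of_real_power)
  then have m: "m\<^sup>2 = 1 + 2 * X * Y * Z - X\<^sup>2 - Y\<^sup>2 - Z\<^sup>2"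
    by (simp add: gram_det_def X_def Y_def Z_def)
  have perm: "gram_det (x v j i) (x v j k) (x v i k) = gram_det (x v i j) (x v i k) (x v j k)"
    "gram_det (x v k i) (x v k j) (x v i j) = gram_det (x v i j) (x v i k) (x v j k)"
    by (simp_all add: gram_det_def x_commute[of v j i] x_commute[of v k])
  have u: "u v i j k * (C * B) = X - Y * Z + \<i> * m" "u v j i k * (C * A) = Y - X * Z + \<i> * m"
    "u v k i j * (B * A) = Z - X * Y + \<i> * m"
    using u_at_vertex[OF assms] u_at_vertex[OF dist(1)] u_at_vertex[OF dist(2)]
    unfolding perm m_def[symmetric]
    by (simp_all add: X_def Y_def Z_def A_def B_def C_def x_commute[of v j i] x_commute[of v k] mult_ac)
  have "(u v i j k * u v j i k * u v k i j * (1 + X + Y + Z - \<i> * m)) * (A\<^sup>2 * B\<^sup>2 * C\<^sup>2)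
      = (u v i j k * (C * B)) * (u v j i k * (C * A)) * (u v k i j * (B * A)) * (1 + X + Y + Z - \<i> * m)"
    by (simp add: power2_eq_square mult_ac)
  also have "\<dots> = - (1 + X + Y + Z + \<i> * m) * (A\<^sup>2 * B\<^sup>2 * C\<^sup>2)"
    unfolding u sq trihedral_product[OF m] by algebra
  finally have *: "u v i j k * u v j i k * u v k i j * (1 + X + Y + Z - \<i> * m) = - (1 + X + Y + Z + \<i> * m)"
    using nz by simp
  have "N v i j k = s v i * s v j * s v k * (1 + X + Y + Z)" "d v i j k = s v i * s v j * s v k * m"
    by (simp_all add: N_def d_def X_def Y_def Z_def m_def add_ac)
  with * show ?thesis by algebra
qed


text \<open>The slope and the intercept of the affine relation \<open>N = A cot (\<Pi>/2) + b\<close>. The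
intercept is read off at the face opposite to \<open>v\<close>.\<close>
definition A :: "'v \<Rightarrow> 'v \<Rightarrow> 'v \<Rightarrow> 'v \<Rightarrow> complex" where
  "A v i j k = 4 * P i j k * P v i j * P v i k * P v j k"

definition b :: "'v \<Rightarrow> 'v \<Rightarrow> 'v \<Rightarrow> 'v \<Rightarrow> complex" where
  "b v i j k = N v i j k - A v i j k * cs ((l i j + l i k + l j k) / 2) / P i j k"

lemma A_commute: "A v i j k = A v j i k" "A v i j k = A v i k j" "A v i j k = A i v j k"
  unfolding A_def by (simp_all add: P_commute mult_ac)

lemma b_commute: "b v i j k = b v j i k" "b v i j k = b v i k j"
  using N_commute[of v i j k] A_commute(1,2)[of v i j k] P_commute[of i j k] l_commute[of i j] l_commute[of j k]
  unfolding b_def by (simp_all add: add_ac)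

lemma A_nonzero: "distinct [v, i, j, k] \<Longrightarrow> A v i j k \<noteq> 0"
  by (auto simp: A_def P_nonzero)

text \<open>The faces opposite to \<open>v\<close> and \<open>w\<close> have half-perimeters
\<open>f\<close> and \<open>g\<close>, and \<open>N_diff\<close> is \<open>A\<close> times the subtraction
formula \<open>cot f - cot g = sn (g - f) / (sn f * sn g)\<close>.\<close>
lemma b_vertex_independent:
  assumes "distinct [v, w, i, j]"
  shows "b v i j w = b w i j v"
proof -
  define f g where "f = (l i j + l i w + l j w) / 2" and "g = (l i j + l i v + l j v) / 2"
  have PP: "P i j w = sn f" "P i j v = sn g" by (simp_all add: P_def f_def g_def)
  have "P i j w \<noteq> 0" "P i j v \<noteq> 0" using assms by (auto simp: P_nonzero)
  then have nz: "sn f \<noteq> 0" "sn g \<noteq> 0" by (simp_all add: PP)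
  have gf: "g - f = (l v i + l v j - l w i - l w j) / 2"
    by (simp add: f_def g_def l_commute[of j w] l_commute[of i w] l_commute[of i v] l_commute[of j v]
        diff_divide_distrib add_divide_distrib)
  have A: "A v i j w = 4 * sn f * sn g * P v w i * P v w j" "A w i j v = 4 * sn f * sn g * P v w i * P v w j"
    unfolding A_def PP[symmetric] by (simp_all add: P_commute mult_ac)
  have "N v i j w - N w i j v = 4 * (sn g * cs f - cs g * sn f) * P v w i * P v w j"
    unfolding N_diff[OF assms] gf[symmetric] sn_diff ..
  moreover have "A v i j w * cs f / sn f = 4 * sn g * P v w i * P v w j * cs f"
    "A w i j v * cs g / sn g = 4 * sn f * P v w i * P v w j * cs g"
    using nz by (simp_all add: A)
  ultimately show ?thesis
    unfolding b_def PP f_def[symmetric] g_def[symmetric] by algebra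
qed

text \<open>The relation \<open>c cot (\<Omega>/2) = a cot (\<Pi>/2) + b\<close>, with \<open>z\<close>
standing for \<open>e\<^sup>i\<^sup>\<Omega>\<close>, cleared of denominators. In this form it has a meaning
when \<open>sn (p / 2) = 0\<close>, which does occur for quadrilaterals on the sphere: for edges of length
\<open>\<pi>/2\<close> their perimeter is \<open>2\<pi>\<close>.\<close>
lemma face_relation:
  assumes dist: "distinct [v, i, j, k]" and p: "p = l i j + l i k + l j k"
    and z: "z = - (u v i j k * u v j i k * u v k i j)"
  shows "(A v i j k * cs (p / 2) + b v i j k * sn (p / 2)) * (z - 1)
    = \<i> * d v i j k * sn (p / 2) * (z + 1)"
proof -
  have P: "P i j k = sn (p / 2)" by (simp add: P_def p)
  have "P i j k \<noteq> 0" using dist by (simp add: P_nonzero)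
  then have NP: "A v i j k * cs (p / 2) + b v i j k * sn (p / 2) = N v i j k * sn (p / 2)"
    unfolding b_def p[symmetric] P by (simp add: field_simps)
  from vertex_angle_sum[OF dist] have "z * (N v i j k - \<i> * d v i j k) = N v i j k + \<i> * d v i j k"
    by (simp add: z)
  then show ?thesis unfolding NP by algebra
qed

text \<open>The edges at \<open>v\<close> and those at \<open>w\<close> give the product of the two vertex
formulas in which the edge \<open>vw\<close> has been counted twice, and has to be divided out. The product
\<open>(N v + \<i>d) (N w + \<i>d) (G - \<i> d s)\<close> turns out to be \<open>- K (M + \<i> d Q)\<close>
with a nonzero common factor \<open>K\<close>; replacing \<open>d\<close> by \<open>-d\<close> gives the
denominator.\<close>
lemma quadrilateral_angle_sum:
  assumes dist: "distinct [v, w, i, j]"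
  defines "Q \<equiv> sn ((l v i + l v j + l w i + l w j) / 2)"
  defines "M \<equiv> N v i j w * Q - 4 * P v i j * T v i j * P v w i * P v w j"
  shows "u v i w j * u v j w i * u w i v j * u w j v i * (M - \<i> * d v i j w * Q)
    = M + \<i> * d v i j w * Q"
proof -
  define z where "z = u v i w j * u v j w i * u w i v j * u w j v i"
  have dist': "distinct [v, i, j, w]" "distinct [w, i, j, v]" "distinct [v, w, j, i]" using dist by auto
  define U Nv Nw D S Gv where "U = u v w i j" and "Nv = N v i j w" and "Nw = N w i j v"
    and "D = d v i j w" and "S = s v w" and "Gv = G v w i j"
  have uc: "u v i j w = u v i w j" "u v j i w = u v j w i" "u w i j v = u w i v j" "u w j i v = u w j v i"
    "u w v i j = U"
    using dist by (auto simp: U_def intro: u_swap_faces u_reverse_edge[symmetric])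
  have v: "u v i w j * u v j w i * U * (Nv - \<i> * D) = - (Nv + \<i> * D)"
    using vertex_angle_sum[OF dist'(1)] by (simp add: uc U_def Nv_def D_def)
  have w: "u w i v j * u w j v i * U * (Nw - \<i> * D) = - (Nw + \<i> * D)"
    using vertex_angle_sum[OF dist'(2)] by (simp add: uc Nw_def D_def d_vertex_independent[OF dist])
  obtain R where R: "U * R = Gv + \<i> * D * S" "R = U * (Gv - \<i> * D * S)"
    using u_direction[OF dist] unfolding U_def Gv_def D_def S_def by blast
  have U: "U \<noteq> 0" by (simp add: U_def u_nonzero)
  have "U\<^sup>2 * (z * ((Nv - \<i> * D) * (Nw - \<i> * D) * (Gv + \<i> * D * S)))
      = U\<^sup>2 * ((Nv + \<i> * D) * (Nw + \<i> * D) * (Gv - \<i> * D * S))"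
    unfolding z_def using v w R by algebra
  with U have z: "z * ((Nv - \<i> * D) * (Nw - \<i> * D) * (Gv + \<i> * D * S))
      = (Nv + \<i> * D) * (Nw + \<i> * D) * (Gv - \<i> * D * S)" by simp
  define h1 h2 t where "h1 = P v w i * T v w i" and "h2 = P v w j * T v w j" and "t = T w v i * T w v j"
  define K where "K = 16 * h1 * h2 * t"
  have h: "h v w i = 2 * h1" "h v w j = 2 * h2" "h v i w = 2 * h1" "h v j w = 2 * h2"
    "h w v i = 2 * P v w i * T w v i" "h w v j = 2 * P v w j * T w v j" "h v i j = 2 * P v i j * T v i j"
    using dist by (auto simp: h_eq h1_def h2_def P_commute T_commute)
  have K: "K \<noteq> 0"
    using dist by (auto simp: K_def h1_def h2_def t_def P_nonzero T_nonzero)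
  have G1: "Gv = S * Nv - 4 * h1 * h2"
    unfolding Gv_def G_def h by (simp add: S_def Nv_def N_commute)
  have G2: "Gv = S * Nw - 4 * P v w i * P v w j * t"
    unfolding Gv_def G_reverse_edge[OF dist] unfolding G_def h
    by (simp add: S_def Nw_def N_commute t_def s_commute mult_ac)
  have D2: "D\<^sup>2 = 16 * P v i j * T v i j * h1 * h2 - Nv\<^sup>2"
    using d_square[OF dist'(1)] by (simp add: h D_def Nv_def mult_ac)
  have sum: "Nv + Nw = 4 * S * P v i j * T v i j + 4 * t * Q"
    using N_add[OF dist] by (simp add: Nv_def Nw_def S_def t_def Q_def mult_ac)
  have M: "M = Nv * Q - 4 * P v i j * T v i j * P v w i * P v w j" by (simp add: M_def Nv_def)
  (* The coefficients of \<i> D and of 1 in (Nv + \<i> D) (Nw + \<i> D) (Gv - \<i> D S). *)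
  have im: "(Nv + Nw) * Gv - (Nv * Nw - D\<^sup>2) * S = - K * Q"
    unfolding K_def using G1 D2 sum by algebra
  have re: "(Nv * Nw - D\<^sup>2) * Gv + D\<^sup>2 * S * (Nv + Nw) = - K * M"
    unfolding K_def M using G1 G2 D2 sum by algebra
  have i: "\<i>\<^sup>2 = - 1" by simp
  have 1: "(Nv + \<i> * D) * (Nw + \<i> * D) * (Gv - \<i> * D * S) = - K * (M + \<i> * D * Q)"
    and 2: "(Nv - \<i> * D) * (Nw - \<i> * D) * (Gv + \<i> * D * S) = - K * (M - \<i> * D * Q)"
    using im re i by algebra+
  from z have "K * (z * (M - \<i> * D * Q)) = K * (M + \<i> * D * Q)"
    unfolding 1 2 by algebra
  with K show ?thesis unfolding z_def D_def by simp
qed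

text \<open>\<open>M\<close> from the previous lemma is \<open>a cs (p / 2) + b sn (p / 2)\<close>: the
perimeters of the quadrilateral and of the face \<open>i j w\<close> differ by twice the argument of
\<open>T v i j\<close>, so the subtraction formula of \<open>sn\<close> accounts for the correction term in
\<open>M\<close>.\<close>
lemma quadrilateral_relation:
  assumes dist: "distinct [v, w, i, j]" and p: "p = l v i + l v j + l w i + l w j"
    and z: "z = u v i w j * u v j w i * u w i v j * u w j v i"
  shows "(A v i j w * cs (p / 2) + b v i j w * sn (p / 2)) * (z - 1)
    = \<i> * d v i j w * sn (p / 2) * (z + 1)"
proof -
  define f where "f = (l i j + l i w + l j w) / 2"
  have Pf: "P i j w = sn f" by (simp add: P_def f_def)
  have "P i j w \<noteq> 0" using dist by (auto simp: P_nonzero)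
  then have nz: "sn f \<noteq> 0" by (simp add: Pf)
  have pf: "p / 2 - f = (l v i + l v j - l i j) / 2"
    unfolding p f_def l_commute[of w i] l_commute[of w j]
    by (simp add: diff_divide_distrib add_divide_distrib)
  have Tf: "T v i j = sn (p / 2) * cs f - cs (p / 2) * sn f"
    unfolding T_def pf[symmetric] sn_diff ..
  have A: "A v i j w = 4 * sn f * P v i j * P v w i * P v w j"
    unfolding A_def Pf by (simp add: P_commute mult_ac)
  have "A v i j w * cs f / sn f = 4 * P v i j * P v w i * P v w j * cs f"
    using nz by (simp add: A)
  then have M: "A v i j w * cs (p / 2) + b v i j w * sn (p / 2)
      = N v i j w * sn (p / 2) - 4 * P v i j * T v i j * P v w i * P v w j"
    unfolding b_def f_def[symmetric] Pf A Tf by algebra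
  from quadrilateral_angle_sum[OF dist] show ?thesis
    unfolding M p[symmetric] z by algebra
qed


text \<open>The heads of the two lists are the zeroth points of the configurations, for which the angle sum
and the perimeter are \<open>0\<close>.\<close>
lemma configuration_relation:
  assumes dist: "distinct [v1, v2, v3, v4]"
  defines "a12 \<equiv> \<alpha> v1 v2 v3 v4" and "a13 \<equiv> \<alpha> v1 v3 v2 v4" and "a14 \<equiv> \<alpha> v1 v4 v2 v3"
    and "a23 \<equiv> \<alpha> v2 v3 v1 v4" and "a24 \<equiv> \<alpha> v2 v4 v1 v3" and "a34 \<equiv> \<alpha> v3 v4 v1 v2"
  shows "\<exists>a b c. a \<noteq> 0 \<and> c \<noteq> 0 \<and>
    list_all2 (\<lambda>z p. (a * cs (p / 2) + b * sn (p / 2)) * (z - 1) = \<i> * c * sn (p / 2) * (z + 1))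
      (1 # map cis [a14 + a24 + a34 - pi, a13 + a23 + a34 - pi, a12 + a23 + a24 - pi,
        a12 + a13 + a14 - pi, a12 + a23 + a34 + a14, a13 + a23 + a24 + a14, a12 + a24 + a34 + a13])
      [0, l v1 v2 + l v1 v3 + l v2 v3, l v1 v2 + l v1 v4 + l v2 v4, l v1 v3 + l v1 v4 + l v3 v4,
       l v2 v3 + l v2 v4 + l v3 v4, l v1 v2 + l v2 v3 + l v3 v4 + l v1 v4,
       l v1 v3 + l v2 v3 + l v2 v4 + l v1 v4, l v1 v2 + l v2 v4 + l v3 v4 + l v1 v3]"
proof -
  define a b' c where "a = A v4 v1 v2 v3" and "b' = b v4 v1 v2 v3" and "c = d v4 v1 v2 v3"
  have A: "A v3 v1 v2 v4 = a" "A v2 v1 v3 v4 = a" "A v1 v2 v3 v4 = a"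
    "A v1 v2 v4 v3 = a" "A v1 v3 v4 v2 = a"
    by (simp_all add: a_def A_commute)
  have b: "b v3 v1 v2 v4 = b'" "b v2 v1 v3 v4 = b'" "b v1 v2 v3 v4 = b'"
    "b v1 v2 v4 v3 = b'" "b v1 v3 v4 v2 = b'"
    using b_vertex_independent[of v4 v3 v1 v2] b_vertex_independent[of v4 v2 v1 v3] b_vertex_independent[of v4 v1 v2 v3] dist
    by (auto simp: b'_def b_commute)
  have c: "d v3 v1 v2 v4 = c" "d v2 v1 v3 v4 = c" "d v1 v2 v3 v4 = c"
    "d v1 v2 v4 v3 = c" "d v1 v3 v4 v2 = c"
    using d_vertex_independent[of v4 v3 v1 v2] d_vertex_independent[of v4 v2 v1 v3] d_vertex_independent[of v4 v1 v2 v3] dist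
    by (auto simp: c_def d_commute)
  note swap = u_reverse_edge[of v4 v1 v2 v3] u_reverse_edge[of v4 v2 v1 v3] u_reverse_edge[of v4 v3 v1 v2]
    u_reverse_edge[of v3 v1 v2 v4] u_reverse_edge[of v3 v2 v1 v4] u_reverse_edge[of v2 v1 v3 v4]
  note comm = u_swap_faces[of v1 v2 v4 v3] u_swap_faces[of v1 v3 v4 v2] u_swap_faces[of v1 v4 v3 v2]
    u_swap_faces[of v2 v3 v4 v1] u_swap_faces[of v2 v4 v3 v1] u_swap_faces[of v3 v4 v2 v1]
    u_reverse_edge[of v4 v2 v3 v1] u_reverse_edge[of v4 v3 v2 v1] u_reverse_edge[of v3 v2 v4 v1]
  have dists: "distinct [v4, v1, v2, v3]" "distinct [v3, v1, v2, v4]" "distinct [v2, v1, v3, v4]"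
    "distinct [v1, v3, v2, v4]" "distinct [v1, v2, v3, v4]" "distinct [v1, v4, v2, v3]" using dist by auto
  have U: "u v4 v1 v2 v3 = cis a14" "u v4 v2 v1 v3 = cis a24" "u v4 v3 v1 v2 = cis a34"
    "u v3 v1 v2 v4 = cis a13" "u v3 v2 v1 v4 = cis a23" "u v3 v4 v1 v2 = cis a34"
    "u v2 v1 v3 v4 = cis a12" "u v2 v3 v1 v4 = cis a23" "u v2 v4 v1 v3 = cis a24"
    "u v1 v2 v3 v4 = cis a12" "u v1 v3 v2 v4 = cis a13" "u v1 v4 v2 v3 = cis a14"
    using swap dist by (auto simp: u_def a12_def a13_def a14_def a23_def a24_def a34_def)
  have U': "u v1 v2 v4 v3 = cis a12" "u v1 v3 v4 v2 = cis a13" "u v1 v4 v3 v2 = cis a14"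
    "u v2 v3 v4 v1 = cis a23" "u v2 v4 v3 v1 = cis a24" "u v3 v4 v2 v1 = cis a34"
    "u v4 v2 v3 v1 = cis a24" "u v4 v3 v2 v1 = cis a34" "u v3 v2 v4 v1 = cis a23"
    using comm dist U by auto
  define R where "R z p \<longleftrightarrow> (a * cs (p / 2) + b' * sn (p / 2)) * (z - 1) = \<i> * c * sn (p / 2) * (z + 1)"
    for z p
  have faces: "R (cis (a14 + a24 + a34 - pi)) (l v1 v2 + l v1 v3 + l v2 v3)"
    "R (cis (a13 + a23 + a34 - pi)) (l v1 v2 + l v1 v4 + l v2 v4)"
    "R (cis (a12 + a23 + a24 - pi)) (l v1 v3 + l v1 v4 + l v3 v4)"
    "R (cis (a12 + a13 + a14 - pi)) (l v2 v3 + l v2 v4 + l v3 v4)"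
    unfolding R_def
    using face_relation[OF dists(1) refl refl] face_relation[OF dists(2) refl refl]
      face_relation[OF dists(3) refl refl] face_relation[OF dists(5) refl refl]
    unfolding U U' A b c a_def[symmetric] b'_def[symmetric] c_def[symmetric]
    by (simp_all add: cis_mult flip: cis_divide)
  have quadrilaterals: "R (cis (a12 + a23 + a34 + a14)) (l v1 v2 + l v2 v3 + l v3 v4 + l v1 v4)"
    "R (cis (a13 + a23 + a24 + a14)) (l v1 v3 + l v2 v3 + l v2 v4 + l v1 v4)"
    "R (cis (a12 + a24 + a34 + a13)) (l v1 v2 + l v2 v4 + l v3 v4 + l v1 v3)"
    unfolding R_def
    using quadrilateral_relation[OF dists(4) _ refl, of "l v1 v2 + l v2 v3 + l v3 v4 + l v1 v4"]
      quadrilateral_relation[OF dists(5) _ refl, of "l v1 v3 + l v2 v3 + l v2 v4 + l v1 v4"]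
      quadrilateral_relation[OF dists(6) _ refl, of "l v1 v2 + l v2 v4 + l v3 v4 + l v1 v3"]
    unfolding U U' A b c a_def[symmetric] b'_def[symmetric] c_def[symmetric]
    by (simp_all add: cis_mult add_ac mult_ac l_commute[of v3 v2] l_commute[of v4 v2] l_commute[of v4 v3])
  have "a \<noteq> 0" "c \<noteq> 0" using dists(1) by (simp_all add: a_def c_def A_nonzero d_nonzero)
  with faces quadrilaterals show ?thesis
    by (intro exI[of _ a] exI[of _ b'] exI[of _ c]) (simp add: sn_0 R_def)
qed

end

section \<open>The configurations\<close>

text \<open>With \<open>w = e\<^sup>i\<^sup>p\<close>, the numbers \<open>cos (p/2)\<close> and \<open>sin
(p/2)\<close> are proportional to \<open>w + 1\<close> and \<open>-\<i> (w - 1)\<close>, so the hypothesis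
is bilinear in \<open>z\<close> and \<open>w\<close>; the coefficients below result from solving it for
\<open>w\<close>.\<close>
lemma projectively_equivalent_circular:
  assumes "a \<noteq> 0" "c \<noteq> 0"
    and rel: "list_all2 (\<lambda>z p. (a * cos (p / 2) + b * sin (p / 2)) * (z - 1) = \<i> * c * sin (p / 2) * (z + 1)) zs ps"
  shows "projectively_equivalent (map Aff zs) (map Aff (map (\<lambda>p. exp (\<i> * p)) ps))"
proof (rule projectively_equivalent_if_bilinear_relation)
  have "\<i>\<^sup>2 = - 1" by simp
  have "(- a - \<i> * b - c) * (- a + \<i> * b - c) - (a + \<i> * b - c) * (a - \<i> * b - c) = 4 * a * c"
    by (simp add: algebra_simps)
  with assms show "(- a - \<i> * b - c) * (- a + \<i> * b - c) - (a + \<i> * b - c) * (a - \<i> * b - c) \<noteq> 0"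
    by simp
  have "exp (\<i> * p) * ((a - \<i> * b - c) * z + (- a + \<i> * b - c)) = (- a - \<i> * b - c) * z + (a + \<i> * b - c)"
    if "(a * cos (p / 2) + b * sin (p / 2)) * (z - 1) = \<i> * c * sin (p / 2) * (z + 1)" for z p
  proof -
    define e e' where "e = exp (\<i> * (p / 2))" and "e' = exp (- (\<i> * (p / 2)))"
    have "e * e' = 1" "exp (\<i> * p) = e\<^sup>2"
      by (simp_all add: e_def e'_def flip: exp_add exp_double)
    moreover have "2 * cos (p / 2) = e + e'" "2 * \<i> * sin (p / 2) = e - e'"
      by (simp_all add: e_def e'_def cos_exp_eq sin_exp_eq)
    ultimately show ?thesis using that \<open>\<i>\<^sup>2 = - 1\<close> by algebra
  qed
  with rel show "list_all2 (\<lambda>z w. w * ((a - \<i> * b - c) * z + (- a + \<i> * b - c))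
      = (- a - \<i> * b - c) * z + (a + \<i> * b - c)) zs (map (\<lambda>p. exp (\<i> * p)) ps)"
    unfolding list_all2_map2 by (elim list_all2_mono) blast
qed

lemma projectively_equivalent_linear:
  assumes "a \<noteq> 0" "c \<noteq> 0"
    and rel: "list_all2 (\<lambda>z p. (a * 1 + b * (p / 2)) * (z - 1) = \<i> * c * (p / 2) * (z + 1)) zs ps"
  shows "projectively_equivalent (map Aff zs) (map Aff ps)"
proof (rule projectively_equivalent_if_bilinear_relation)
  have "(- 2 * a) * (- b - \<i> * c) - 2 * a * (b - \<i> * c) = 4 * \<i> * a * c"
    by (simp add: algebra_simps)
  with assms show "(- 2 * a) * (- b - \<i> * c) - 2 * a * (b - \<i> * c) \<noteq> 0"
    by simp
  have "p * ((b - \<i> * c) * z + (- b - \<i> * c)) = (- 2 * a) * z + 2 * a"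
    if "(a * 1 + b * (p / 2)) * (z - 1) = \<i> * c * (p / 2) * (z + 1)" for z p
  proof -
    define r where "r = p / 2"
    have "p = 2 * r" by (simp add: r_def)
    with that[folded r_def] show ?thesis by algebra
  qed
  with rel show "list_all2 (\<lambda>z p. p * ((b - \<i> * c) * z + (- b - \<i> * c)) = (- 2 * a) * z + 2 * a) zs ps"
    by (elim list_all2_mono) blast
qed

section \<open>The three geometries\<close>

text \<open>What the three geometries have in common: initial directions \<open>dir v w\<close> at
\<open>v\<close> of the edges, and a form \<open>B\<close> that is positive definite on the tangent spaces.
The directions are normalised to have length \<open>sn (l v w)\<close> up to the phase
\<open>\<rho>\<close>, so that the law of cosines becomes a formula for \<open>B\<close> without
denominators.\<close>
locale tetrahedral_frames = length_functions +
  fixes l :: "4 \<Rightarrow> 4 \<Rightarrow> complex" and B :: "'a::real_vector \<Rightarrow> 'a \<Rightarrow> real"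
    and dir :: "4 \<Rightarrow> 4 \<Rightarrow> 'a" and \<rho> :: complex
  assumes bilinear: "bilinear B" and B_commute: "B y z = B z y"
    and positive: "distinct [v, i, j, k] \<Longrightarrow> pos_def_on B (dir v i) (dir v j) (dir v k)"
    and length_commute: "l v w = l w v"
    and scale_nonzero: "\<rho> \<noteq> 0"
    and sn_eq_norm: "v \<noteq> w \<Longrightarrow> sn (l v w) = \<rho> * of_real (sqrt (B (dir v w) (dir v w)))"
    and cosine_law: "distinct [v, i, j] \<Longrightarrow> sn (l v i) * sn (l v j) + \<rho>\<^sup>2 * of_real (B (dir v i) (dir v j))
      = 2 * sn ((l v i + l v j + l i j) / 2) * sn ((l v i + l v j - l i j) / 2)"
begin

lemma fourth_vertex: "\<exists>k::4. distinct [v, i, j, k]" if "distinct [v, i, j]"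
proof -
  have "card {v, i, j} < CARD(4)" using card_length[of "[v, i, j]"] by simp
  then have "{v, i, j} \<noteq> UNIV" by auto
  then obtain k where "k \<notin> {v, i, j}" by blast
  with that show ?thesis by auto
qed

lemma norm_positive: "B (dir v i) (dir v i) > 0" if "v \<noteq> i"
proof -
  have "card {v, i} < CARD(4)" using card_length[of "[v, i]"] by simp
  then have "{v, i} \<noteq> UNIV" by auto
  then obtain j where "j \<notin> {v, i}" by blast
  with that have "distinct [v, i, j]" by auto
  then obtain k where "distinct [v, i, j, k]" using fourth_vertex by blast
  from positive[OF this, unfolded pos_def_on_def, rule_format, of 1 0 0] show ?thesis by simp
qed

sublocale tetrahedral_data sn cs q l "\<lambda>v i j. form_cos B (dir v i) (dir v j)"
  "\<lambda>v w i j. half_plane_angle B (dir v w) (dir v i) (dir v j)" \<rho>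
proof
  fix v w i j k :: 4
  show "l v w = l w v" by (rule length_commute)
  show "form_cos B (dir v i) (dir v j) = form_cos B (dir v j) (dir v i)"
    by (simp add: form_cos_def B_commute[of "dir v i" "dir v j"] mult.commute)
  show "\<rho> \<noteq> 0" by (rule scale_nonzero)
  show "\<exists>r>0. sn (l v w) = \<rho> * of_real r" if "v \<noteq> w"
    using sn_eq_norm[OF that] norm_positive[OF that] real_sqrt_gt_zero by blast
  show "(form_cos B (dir v i) (dir v j))\<^sup>2 < 1" if "distinct [v, i, j]"
    using fourth_vertex[OF that] dihedral_angle_of_trihedron(1)[OF bilinear B_commute positive] by blast
  show "gram_det (form_cos B (dir v i) (dir v j)) (form_cos B (dir v i) (dir v k)) (form_cos B (dir v j) (dir v k)) > 0"
    if "distinct [v, i, j, k]"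
    by (rule dihedral_angle_of_trihedron(2)[OF bilinear B_commute positive[OF that]])
  show "sn (l v i) * sn (l v j) * (1 + form_cos B (dir v i) (dir v j))
      = 2 * sn ((l v i + l v j + l i j) / 2) * sn ((l v i + l v j - l i j) / 2)" if "distinct [v, i, j]"
  proof -
    have ne: "v \<noteq> i" "v \<noteq> j" using that by auto
    define r t where "r = sqrt (B (dir v i) (dir v i))" and "t = sqrt (B (dir v j) (dir v j))"
    have "r \<noteq> 0" "t \<noteq> 0" using norm_positive[OF ne(1)] norm_positive[OF ne(2)] by (simp_all add: r_def t_def)
    then have "B (dir v i) (dir v j) = r * t * form_cos B (dir v i) (dir v j)"
      by (simp add: form_cos_def r_def t_def)
    then show ?thesis
      unfolding cosine_law[OF that, symmetric] unfolding sn_eq_norm[OF ne(1)] sn_eq_norm[OF ne(2)]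
        r_def[symmetric] t_def[symmetric] by (simp add: power2_eq_square algebra_simps)
  qed
  show "cis (half_plane_angle B (dir v w) (dir v i) (dir v j))
      * (sqrt (1 - (form_cos B (dir v w) (dir v i))\<^sup>2) * sqrt (1 - (form_cos B (dir v w) (dir v j))\<^sup>2))
    = Complex (form_cos B (dir v i) (dir v j) - form_cos B (dir v w) (dir v i) * form_cos B (dir v w) (dir v j))
        (sqrt (gram_det (form_cos B (dir v w) (dir v i)) (form_cos B (dir v w) (dir v j)) (form_cos B (dir v i) (dir v j))))"
    if "distinct [v, w, i, j]"
    using dihedral_angle_of_trihedron(3)[OF bilinear B_commute positive[OF that]] by simp
qed

end

lemma Omega_config_eq:
  "Omega_config T = map Aff (1 # map cis (Omegas T))"
  by (simp add: Omega_config_def cis_conv_exp)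

lemma independent_family_combination:
  fixes A :: "'i \<Rightarrow> 'a::real_vector"
  assumes "inj A" "independent (range A)" "distinct [v, i, j, k]"
    and "p *\<^sub>R A v + a *\<^sub>R A i + b *\<^sub>R A j + c *\<^sub>R A k = 0"
  shows "a = 0 \<and> b = 0 \<and> c = 0"
proof -
  define S where "S = {A v, A i, A j, A k}"
  have ne: "A v \<noteq> A i" "A v \<noteq> A j" "A v \<noteq> A k" "A i \<noteq> A j" "A i \<noteq> A k" "A j \<noteq> A k"
    using assms(1,3) by (auto dest: injD)
  have "independent S" using assms(2) by (rule independent_mono) (auto simp: S_def)
  then have "\<not> (\<exists>f. (\<exists>y\<in>S. f y \<noteq> 0) \<and> (\<Sum>y\<in>S. f y *\<^sub>R y) = 0)"
    by (subst (asm) dependent_finite) (auto simp: S_def)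
  moreover define f where "f = (\<lambda>y. if y = A v then p else if y = A i then a else if y = A j then b else c)"
  have "(\<Sum>y\<in>S. f y *\<^sub>R y) = 0"
    using assms(4) ne by (simp add: S_def f_def add_ac)
  ultimately have "\<forall>y\<in>S. f y = 0" by blast
  then show ?thesis using ne by (simp add: S_def f_def)
qed

subsection \<open>Spherical\<close>

lemma spherical_configurations_equivalent:
  assumes "geodesic_tetrahedron (Spherical A)"
  shows "projectively_equivalent (Omega_config (Spherical A)) (Pi_config (Spherical A))"
proof -
  define l where "l v w = complex_of_real (arccos (A v \<bullet> A w))" for v w
  have unit: "A v \<bullet> A v = 1" for v
  proof -
    have "norm (A v) = 1" using assms by (auto simp: image_subset_iff)
    then show ?thesis by (simp add: dot_square_norm)
  qed
  have dir_dir: "sphere_dir (A v) (A i) \<bullet> sphere_dir (A v) (A j) = A i \<bullet> A j - (A v \<bullet> A i) * (A v \<bullet> A j)" for v i j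
    by (simp add: sphere_dir_def inner_diff unit inner_commute)
  interpret tetrahedral_frames sin cos "\<lambda>x. - sin x" l "(\<bullet>)" "\<lambda>v i. sphere_dir (A v) (A i)" 1
  proof
    fix v w i j k :: 4
    show "bilinear ((\<bullet>) :: real^4 \<Rightarrow> _)"
      by (simp add: bilinear_conv_bounded_bilinear bounded_bilinear_inner)
    show "pos_def_on (\<bullet>) (sphere_dir (A v) (A i)) (sphere_dir (A v) (A j)) (sphere_dir (A v) (A k))"
      if "distinct [v, i, j, k]"
      unfolding pos_def_on_def inner_gt_zero_iff
    proof (intro allI impI notI)
      fix a b c
      assume "a \<noteq> 0 \<or> b \<noteq> 0 \<or> c \<noteq> 0"
        and "a *\<^sub>R sphere_dir (A v) (A i) + b *\<^sub>R sphere_dir (A v) (A j) + c *\<^sub>R sphere_dir (A v) (A k) = 0"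
      then show False
        using independent_family_combination[of A v i j k
            "- (a * (A v \<bullet> A i) + b * (A v \<bullet> A j) + c * (A v \<bullet> A k))" a b c] assms that
        by (simp add: sphere_dir_def algebra_simps)
    qed
    show "l v w = l w v" by (simp add: l_def inner_commute)
    have bound: "\<bar>A v \<bullet> A w\<bar> \<le> 1" for v w
      using Cauchy_Schwarz_ineq2[of "A v" "A w"] assms by (auto simp: norm_eq_sqrt_inner unit)
    have sin_l: "sin (l v w) = of_real (sqrt (1 - (A v \<bullet> A w)\<^sup>2))" for v w
      unfolding l_def sin_of_real sin_arccos_abs[OF bound] ..
    have cos_l: "cos (l v w) = of_real (A v \<bullet> A w)" for v w
      unfolding l_def cos_of_real cos_arccos_abs[OF bound] ..
    show "sin (l v w) = 1 * of_real (sqrt (sphere_dir (A v) (A w) \<bullet> sphere_dir (A v) (A w)))" if "v \<noteq> w"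
      by (simp add: sin_l dir_dir unit power2_eq_square)
    have "2 * sin ((l v i + l v j + l i j) / 2) * sin ((l v i + l v j - l i j) / 2)
        = cos (l i j) - cos (l v i + l v j)"
      by (simp add: cos_diff_cos add.commute)
    then show "sin (l v i) * sin (l v j) + 1\<^sup>2 * of_real (sphere_dir (A v) (A i) \<bullet> sphere_dir (A v) (A j))
      = 2 * sin ((l v i + l v j + l i j) / 2) * sin ((l v i + l v j - l i j) / 2)"
      by (simp add: cos_add cos_l dir_dir)
  qed (simp_all add: inner_commute)
  obtain a b c where "a \<noteq> 0" "c \<noteq> 0" and rel:
    "list_all2 (\<lambda>z p. (a * cos (p / 2) + b * sin (p / 2)) * (z - 1) = \<i> * c * sin (p / 2) * (z + 1))
      (1 # map cis (Omegas (Spherical A))) (map of_real (0 # Pis (Spherical A)))"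
    using configuration_relation[of 1 2 3 4] by (auto simp: Omegas_def Pis_def Let_def l_def)
  have "Pi_config (Spherical A)
      = map Aff (map (\<lambda>p. exp (\<i> * p)) (map of_real (0 # Pis (Spherical A))))"
    by (simp add: Pi_config_def)
  then show ?thesis
    using projectively_equivalent_circular[OF \<open>a \<noteq> 0\<close> \<open>c \<noteq> 0\<close> rel] by (simp only: Omega_config_eq)
qed

subsection \<open>Euclidean\<close>

lemma euclidean_configurations_equivalent:
  assumes "geodesic_tetrahedron (Euclidean A)"
  shows "projectively_equivalent (Omega_config (Euclidean A)) (Pi_config (Euclidean A))"
proof -
  define l where "l v w = complex_of_real (dist (A v) (A w))" for v w
  interpret tetrahedral_frames "\<lambda>x. x" "\<lambda>x. 1" "\<lambda>x. x ^ 3 / 6" l "(\<bullet>)" "\<lambda>v i. A i - A v" 1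
  proof
    fix v w i j k :: 4
    show "bilinear ((\<bullet>) :: real^3 \<Rightarrow> _)"
      by (simp add: bilinear_conv_bounded_bilinear bounded_bilinear_inner)
    show "pos_def_on (\<bullet>) (A i - A v) (A j - A v) (A k - A v)" if "distinct [v, i, j, k]"
      unfolding pos_def_on_def inner_gt_zero_iff
    proof (intro allI impI notI)
      fix a b c
      assume nz: "a \<noteq> 0 \<or> b \<noteq> 0 \<or> c \<noteq> 0"
        and "a *\<^sub>R (A i - A v) + b *\<^sub>R (A j - A v) + c *\<^sub>R (A k - A v) = 0"
      then have sum: "(- (a + b + c)) *\<^sub>R A v + a *\<^sub>R A i + b *\<^sub>R A j + c *\<^sub>R A k = 0"
        by (simp add: algebra_simps)
      define S where "S = {A v, A i, A j, A k}"
      have ne: "A v \<noteq> A i" "A v \<noteq> A j" "A v \<noteq> A k" "A i \<noteq> A j" "A i \<noteq> A k" "A j \<noteq> A k"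
        using assms that by (auto dest: injD)
      define f where "f = (\<lambda>y. if y = A v then - (a + b + c) else if y = A i then a else if y = A j then b else c)"
      have "sum f S = 0" "(\<Sum>y\<in>S. f y *\<^sub>R y) = 0" "\<exists>y\<in>S. f y \<noteq> 0"
        using sum ne nz by (simp_all add: S_def f_def add_ac)
      then have "affine_dependent S"
        by (subst affine_dependent_explicit_finite) (auto simp: S_def)
      then have "affine_dependent (range A)"
        using affine_independent_subset[of "range A" S] by (auto simp: S_def)
      with assms show False by simp
    qed
    show "l v w = l w v" by (simp add: l_def dist_commute)
    show "l v w = 1 * of_real (sqrt ((A w - A v) \<bullet> (A w - A v)))" if "v \<noteq> w"
      by (simp add: l_def dist_norm norm_minus_commute flip: norm_eq_sqrt_inner)
    define p q r where "p = dist (A v) (A i)" and "q = dist (A v) (A j)" and "r = dist (A i) (A j)"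
    have "r\<^sup>2 = p\<^sup>2 + q\<^sup>2 - 2 * ((A i - A v) \<bullet> (A j - A v))"
      by (simp add: p_def q_def r_def dist_norm power2_norm_eq_inner inner_diff inner_commute)
    then have "p * q + (A i - A v) \<bullet> (A j - A v) = 2 * ((p + q + r) / 2) * ((p + q - r) / 2)"
      by (simp add: field_simps power2_eq_square)
    from arg_cong[OF this, of complex_of_real]
    show "l v i * l v j + 1\<^sup>2 * of_real ((A i - A v) \<bullet> (A j - A v))
      = 2 * ((l v i + l v j + l i j) / 2) * ((l v i + l v j - l i j) / 2)"
      by (simp add: l_def p_def q_def r_def)
  qed (simp_all add: inner_commute)
  obtain a b c where "a \<noteq> 0" "c \<noteq> 0" and rel:
    "list_all2 (\<lambda>z p. (a * 1 + b * (p / 2)) * (z - 1) = \<i> * c * (p / 2) * (z + 1))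
      (1 # map cis (Omegas (Euclidean A))) (map of_real (0 # Pis (Euclidean A)))"
    using configuration_relation[of 1 2 3 4] by (auto simp: Omegas_def Pis_def Let_def l_def)
  have "Pi_config (Euclidean A) = map Aff (map of_real (0 # Pis (Euclidean A)))"
    by (simp add: Pi_config_def)
  then show ?thesis
    using projectively_equivalent_linear[OF \<open>a \<noteq> 0\<close> \<open>c \<noteq> 0\<close> rel] by (simp only: Omega_config_eq)
qed

subsection \<open>Hyperbolic\<close>

lemma lorentz_commute: "lorentz x y = lorentz y x"
  by (simp add: lorentz_def mult.commute)

lemma bilinear_lorentz: "bilinear lorentz"
  unfolding bilinear_def by (auto intro!: linearI simp: lorentz_def algebra_simps)

lemma spatial_Cauchy_Schwarz:
  fixes p y :: "real ^ 4"
  shows "(p $ 1 * y $ 1 + p $ 2 * y $ 2 + p $ 3 * y $ 3)\<^sup>2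
    \<le> ((p $ 1)\<^sup>2 + (p $ 2)\<^sup>2 + (p $ 3)\<^sup>2) * ((y $ 1)\<^sup>2 + (y $ 2)\<^sup>2 + (y $ 3)\<^sup>2)" (is "?l \<le> ?r")
proof -
  have "?r - ?l = (p $ 1 * y $ 2 - p $ 2 * y $ 1)\<^sup>2 + (p $ 1 * y $ 3 - p $ 3 * y $ 1)\<^sup>2
      + (p $ 2 * y $ 3 - p $ 3 * y $ 2)\<^sup>2"
    by algebra
  also have "\<dots> \<ge> 0" by simp
  finally show ?thesis by simp
qed

text \<open>The time component of a tangent vector is controlled by its spatial part: if \<open>P\<close>
and \<open>Y\<close> are the squared lengths of the spatial parts of \<open>p\<close> and \<open>y\<close>,
then Cauchy-Schwarz gives \<open>(1 + P) (y $ 4)\<^sup>2 \<le> P Y\<close>.\<close>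
lemma lorentz_positive_on_tangent_space:
  assumes "p \<in> hyperboloid" "lorentz p y = 0" "y \<noteq> 0"
  shows "lorentz y y > 0"
proof -
  define P Y where "P = (p $ 1)\<^sup>2 + (p $ 2)\<^sup>2 + (p $ 3)\<^sup>2" and "Y = (y $ 1)\<^sup>2 + (y $ 2)\<^sup>2 + (y $ 3)\<^sup>2"
  have p4: "(p $ 4)\<^sup>2 = 1 + P"
    using assms(1) by (simp add: hyperboloid_def lorentz_def P_def power2_eq_square)
  have P: "P \<ge> 0" and Y: "Y \<ge> 0" by (simp_all add: P_def Y_def)
  have py: "p $ 4 * y $ 4 = p $ 1 * y $ 1 + p $ 2 * y $ 2 + p $ 3 * y $ 3"
    using assms(2) by (simp add: lorentz_def)
  have "(p $ 4 * y $ 4)\<^sup>2 \<le> P * Y"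
    using spatial_Cauchy_Schwarz[of p y] by (simp add: py P_def Y_def)
  then have le: "(1 + P) * (y $ 4)\<^sup>2 \<le> P * Y" by (simp add: power_mult_distrib p4)
  have "Y > 0"
  proof (rule ccontr)
    assume "\<not> Y > 0"
    with Y have "Y = 0" by simp
    with le P have "y $ 4 = 0" by (simp add: mult_le_0_iff)
    moreover have "y $ 1 = 0 \<and> y $ 2 = 0 \<and> y $ 3 = 0"
      using \<open>Y = 0\<close> by (simp add: Y_def add_nonneg_eq_0_iff)
    ultimately show False using assms(3) by (simp add: vec_eq_iff forall_4)
  qed
  then have "(1 + P) * (y $ 4)\<^sup>2 < (1 + P) * Y" using le P by (simp add: algebra_simps)
  then have "(y $ 4)\<^sup>2 < Y" using P by simp
  then show ?thesis by (simp add: lorentz_def Y_def power2_eq_square)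
qed

text \<open>The projection \<open>z\<close> of \<open>y\<close> to the tangent space at \<open>p\<close> has
square \<open>(lorentz p y)\<^sup>2 - 1\<close>, which is positive unless \<open>z = 0\<close>; the sign of
\<open>lorentz p y\<close> comes from \<open>p\<close> and \<open>y\<close> lying on the same sheet. This
makes the hyperbolic edge lengths positive.\<close>
lemma minus_lorentz_gt_1:
  assumes "p \<in> hyperboloid" "y \<in> hyperboloid" "p \<noteq> y"
  shows "- lorentz p y > 1"
proof -
  note [simp] = bilinear_ladd[OF bilinear_lorentz] bilinear_radd[OF bilinear_lorentz]
    bilinear_lmul[OF bilinear_lorentz] bilinear_rmul[OF bilinear_lorentz]
  have unit: "lorentz p p = - 1" "lorentz y y = - 1" and pos: "p $ 4 > 0" "y $ 4 > 0"
    using assms by (auto simp: hyperboloid_def)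
  define X where "X = p $ 1 * y $ 1 + p $ 2 * y $ 2 + p $ 3 * y $ 3"
  have sq: "(p $ 1)\<^sup>2 + (p $ 2)\<^sup>2 + (p $ 3)\<^sup>2 = (p $ 4)\<^sup>2 - 1"
    "(y $ 1)\<^sup>2 + (y $ 2)\<^sup>2 + (y $ 3)\<^sup>2 = (y $ 4)\<^sup>2 - 1"
    using unit by (simp_all add: lorentz_def power2_eq_square)
  have "X\<^sup>2 \<le> ((p $ 4)\<^sup>2 - 1) * ((y $ 4)\<^sup>2 - 1)"
    using spatial_Cauchy_Schwarz[of p y] unfolding sq X_def .
  also have "\<dots> = (p $ 4 * y $ 4)\<^sup>2 + 1 - (p $ 4)\<^sup>2 - (y $ 4)\<^sup>2"
    by algebra
  also have "\<dots> < (p $ 4 * y $ 4)\<^sup>2"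
  proof -
    have "(p $ 4)\<^sup>2 \<ge> 1" using sq(1) zero_le_power2[of "p $ 1"] zero_le_power2[of "p $ 2"] zero_le_power2[of "p $ 3"] by linarith
    moreover have "(y $ 4)\<^sup>2 > 0" using pos by simp
    ultimately show ?thesis by linarith
  qed
  finally have "X < p $ 4 * y $ 4" using pos power2_less_imp_less[of X] by simp
  then have neg: "lorentz p y < 0" by (simp add: lorentz_def X_def)
  define z where "z = y + lorentz p y *\<^sub>R p"
  have "z \<noteq> 0"
  proof
    assume "z = 0"
    define t where "t = - lorentz p y"
    from \<open>z = 0\<close> have y: "y = t *\<^sub>R p" by (simp add: z_def t_def eq_neg_iff_add_eq_0)
    then have "lorentz y y = t * (t * lorentz p p)" by simp
    then have "t\<^sup>2 = 1" by (simp add: unit power2_eq_square)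
    moreover have "t > 0" using neg by (simp add: t_def)
    ultimately have "t = 1" by (simp add: power2_eq_1_iff)
    with y have "y = p" by simp
    with assms(3) show False by simp
  qed
  then have "lorentz z z > 0"
    by (intro lorentz_positive_on_tangent_space[OF assms(1)]) (simp_all add: z_def unit)
  then have "1\<^sup>2 < (- lorentz p y)\<^sup>2"
    by (simp add: z_def unit lorentz_commute[of y p] power2_eq_square)
  then show ?thesis using neg power2_less_imp_less[of 1 "- lorentz p y"] by simp
qed

lemma sin_minus_i_times: "sin (- \<i> * complex_of_real t) = - \<i> * of_real (sinh t)"
  and cos_minus_i_times: "cos (- \<i> * complex_of_real t) = of_real (cosh t)"
proof -
  have arg: "\<i> * (- \<i> * complex_of_real t) = of_real t" by simp
  have exps: "exp (complex_of_real t) = of_real (exp t)" "exp (- complex_of_real t) = of_real (exp (- t))"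
    by (simp_all add: exp_of_real flip: of_real_minus)
  show "sin (- \<i> * complex_of_real t) = - \<i> * of_real (sinh t)"
    unfolding sin_exp_eq arg exps sinh_field_def by (simp add: divide_simps)
  show "cos (- \<i> * complex_of_real t) = of_real (cosh t)"
    unfolding cos_exp_eq arg exps cosh_field_def by simp
qed

lemma hyperbolic_configurations_equivalent:
  assumes "geodesic_tetrahedron (Hyperbolic A)"
  shows "projectively_equivalent (Omega_config (Hyperbolic A)) (Pi_config (Hyperbolic A))"
proof -
  define l where "l v w = - \<i> * complex_of_real (arcosh (- lorentz (A v) (A w)))" for v w
  have hyp: "A v \<in> hyperboloid" for v using assms by auto
  have unit: "lorentz (A v) (A v) = - 1" for v using hyp[of v] by (simp add: hyperboloid_def)
  note [simp] = bilinear_ladd[OF bilinear_lorentz] bilinear_radd[OF bilinear_lorentz]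
    bilinear_lmul[OF bilinear_lorentz] bilinear_rmul[OF bilinear_lorentz]
  have dir_dir: "lorentz (hyperboloid_dir (A v) (A i)) (hyperboloid_dir (A v) (A j))
      = lorentz (A i) (A j) + lorentz (A v) (A i) * lorentz (A v) (A j)" for v i j
    by (simp add: hyperboloid_dir_def unit lorentz_commute[of "A i" "A v"] algebra_simps)
  interpret tetrahedral_frames sin cos "\<lambda>x. - sin x" l lorentz "\<lambda>v i. hyperboloid_dir (A v) (A i)" "- \<i>"
  proof
    fix v w i j k :: 4
    show "bilinear lorentz" by (rule bilinear_lorentz)
    show "lorentz y z = lorentz z y" for y z by (rule lorentz_commute)
    show "pos_def_on lorentz (hyperboloid_dir (A v) (A i)) (hyperboloid_dir (A v) (A j)) (hyperboloid_dir (A v) (A k))"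
      if "distinct [v, i, j, k]"
      unfolding pos_def_on_def
    proof (intro allI impI lorentz_positive_on_tangent_space[OF hyp[of v]] notI)
      fix a b c
      show "lorentz (A v) (a *\<^sub>R hyperboloid_dir (A v) (A i) + b *\<^sub>R hyperboloid_dir (A v) (A j)
          + c *\<^sub>R hyperboloid_dir (A v) (A k)) = 0"
        by (simp add: hyperboloid_dir_def unit)
      assume "a \<noteq> 0 \<or> b \<noteq> 0 \<or> c \<noteq> 0"
        and "a *\<^sub>R hyperboloid_dir (A v) (A i) + b *\<^sub>R hyperboloid_dir (A v) (A j)
          + c *\<^sub>R hyperboloid_dir (A v) (A k) = 0"
      then show False
        using independent_family_combination[of A v i j k
            "a * lorentz (A v) (A i) + b * lorentz (A v) (A j) + c * lorentz (A v) (A k)" a b c] assms that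
        by (simp add: hyperboloid_dir_def algebra_simps)
    qed
    show "l v w = l w v" by (simp add: l_def lorentz_commute)
    have ge1: "- lorentz (A v) (A w) \<ge> 1" for v w
      using minus_lorentz_gt_1[OF hyp hyp, of v w] unit[of w] by (cases "A v = A w") auto
    have sin_l: "sin (l v w) = - \<i> * of_real (sqrt ((lorentz (A v) (A w))\<^sup>2 - 1))" for v w
      unfolding l_def sin_minus_i_times sinh_arcosh_real[OF ge1] by simp
    have cos_l: "cos (l v w) = of_real (- lorentz (A v) (A w))" for v w
      unfolding l_def cos_minus_i_times cosh_arcosh_real[OF ge1] ..
    show "sin (l v w) = - \<i> * of_real (sqrt (lorentz (hyperboloid_dir (A v) (A w)) (hyperboloid_dir (A v) (A w))))"
      if "v \<noteq> w"
      by (simp add: sin_l dir_dir unit power2_eq_square)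
    have "2 * sin ((l v i + l v j + l i j) / 2) * sin ((l v i + l v j - l i j) / 2)
        = cos (l i j) - cos (l v i + l v j)"
      by (simp add: cos_diff_cos add.commute)
    then show "sin (l v i) * sin (l v j)
        + (- \<i>)\<^sup>2 * of_real (lorentz (hyperboloid_dir (A v) (A i)) (hyperboloid_dir (A v) (A j)))
      = 2 * sin ((l v i + l v j + l i j) / 2) * sin ((l v i + l v j - l i j) / 2)"
      by (simp add: cos_add cos_l dir_dir)
  qed simp_all
  obtain a b c where "a \<noteq> 0" "c \<noteq> 0" and rel:
    "list_all2 (\<lambda>z p. (a * cos (p / 2) + b * sin (p / 2)) * (z - 1) = \<i> * c * sin (p / 2) * (z + 1))
      (1 # map cis (Omegas (Hyperbolic A))) (map (\<lambda>t. - \<i> * of_real t) (0 # Pis (Hyperbolic A)))"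
    using configuration_relation[of 1 2 3 4] by (auto simp: Omegas_def Pis_def Let_def l_def algebra_simps)
  have "Pi_config (Hyperbolic A)
      = map Aff (map (\<lambda>p. exp (\<i> * p)) (map (\<lambda>t. - \<i> * of_real t) (0 # Pis (Hyperbolic A))))"
    by (simp add: Pi_config_def exp_of_real)
  then show ?thesis
    using projectively_equivalent_circular[OF \<open>a \<noteq> 0\<close> \<open>c \<noteq> 0\<close> rel] by (simp only: Omega_config_eq)
qed

theorem theorem1p1:
  fixes T :: tetrahedron
  assumes "geodesic_tetrahedron T"
  shows "projectively_equivalent (Omega_config T) (Pi_config T)"
  using assms spherical_configurations_equivalent euclidean_configurations_equivalent hyperbolic_configurations_equivalent by (cases T) blast+

end
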